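(* There is a deterministic algorithm that, given a weighted metric space $(V,w,d)$ of size $n$, a subset $X\subseteq V$, and a parameter $k'\ge k$, returns a solution $S\subseteq X$ of size $k'$ in $\tilde O(n|X|)$ time such that $$\mathrm{cost}(S)\le \mathrm{cost}(X)+O\!\left(\log\!\left(\frac{|X|}{k'-k+1}\right)\right)\cdot\mathrm{OPT}_k(V).$$
   Context: A weighted metric space $(V,w,d)$: finite set $V$, weights $w:V\to\mathbb{R}_{\ge0}$, metric $d$. For $S,U\subseteq V$, $d(x,S)=\min_{y\in S}d(x,y)$, $\mathrm{cost}(S,U)=\sum_{x\in U}w(x)d(x,S)$, $\mathrm{cost}(S)=\mathrm{cost}(S,V)$, and $\mathrm{OPT}_k(V)=\min_{S\subseteq V,|S|=k}\mathrm{cost}(S,V)$. The algorithm accesses the metric via distance queries; $\tilde O(\cdot)$ hides factors polylogarithmic in $n$ and the aspect ratio (ratio of maximum to minimum non-zero distance). *)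

theory Defs
  imports "HOL-Analysis.Analysis" "HOL-Library.Log_Nat"
begin

section \<open>Weighted metric spaces and the $k$-median objective\<close>

locale weighted_metric_space = Metric_space V d
  for V :: "'a set" and w :: "'a \<Rightarrow> real" and d :: "'a \<Rightarrow> 'a \<Rightarrow> real" +
  assumes finite_space: "finite V"
    and weight_nonneg: "x \<in> V \<Longrightarrow> 0 \<le> w x"

text \<open>As for every use of \<^const>\<open>Min\<close>, the next two notions are only meaningful when the minimum
  ranges over a nonempty finite set: \<open>S\<close> finite and nonempty, respectively \<open>V\<close> finite and
  \<open>1 \<le> k \<le> card V\<close>.\<close>

definition dist_set :: "('a \<Rightarrow> 'a \<Rightarrow> real) \<Rightarrow> 'a \<Rightarrow> 'a set \<Rightarrow> real" where
  "dist_set d x S = Min (d x ` S)"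

definition cost :: "('a \<Rightarrow> real) \<Rightarrow> ('a \<Rightarrow> 'a \<Rightarrow> real) \<Rightarrow> 'a set \<Rightarrow> 'a set \<Rightarrow> real" where
  "cost w d S U = (\<Sum>x\<in>U. w x * dist_set d x S)"

definition OPT :: "'a set \<Rightarrow> ('a \<Rightarrow> real) \<Rightarrow> ('a \<Rightarrow> 'a \<Rightarrow> real) \<Rightarrow> nat \<Rightarrow> real" where
  "OPT V w d k = Min {cost w d S V | S. S \<subseteq> V \<and> card S = k}"

definition nonzero_dists :: "'a set \<Rightarrow> ('a \<Rightarrow> 'a \<Rightarrow> real) \<Rightarrow> real set" where
  "nonzero_dists V d = {d x y | x y. x \<in> V \<and> y \<in> V \<and> d x y \<noteq> 0}"

text \<open>A one-point space has no nonzero distance; its aspect ratio is set to 1.\<close>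

definition aspect_ratio :: "'a set \<Rightarrow> ('a \<Rightarrow> 'a \<Rightarrow> real) \<Rightarrow> real" where
  "aspect_ratio V d =
     (if nonzero_dists V d = {} then 1
      else Max (nonzero_dists V d) / Min (nonzero_dists V d))"


section \<open>Deterministic algorithms with distance queries\<close>

text \<open>
  Algorithms are programs for a real RAM with distance queries, given as a while language.
  The memory consists of natural-number arrays and real arrays; a program is a finite
  piece of syntax and so mentions finitely many arrays.  Points are handled by the machine only
  through their positions in an enumeration of \<open>V\<close>.

  Operations on reals, including a distance query, have unit cost.  There is no rounding and no
  conversion from reals to naturals; reals affect control only through comparisons.
  Operations on naturals, including those that compute addresses, are charged the bit length of
  the value they produce (logarithmic cost criterion), so that large words are not free.
  For values polynomial in the input size this differs from the unit-cost word RAM by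
  a logarithmic factor only.
\<close>

datatype nexp =
    Const nat
  | NRead nat nexp
  | NAdd nexp nexp
  | NSub nexp nexp
  | NMul nexp nexp
  | NDiv nexp nexp

datatype rexp =
    OfNat nexp
  | RRead nat nexp
  | Query nexp nexp
  | RAdd rexp rexp
  | RSub rexp rexp
  | RMul rexp rexp

datatype bexp =
    NLess nexp nexp
  | RLess rexp rexp
  | Not bexp
  | And bexp bexp

datatype com =
    Skip
  | NStore nat nexp nexp  \<comment> \<open>array name, cell, value\<close>
  | RStore nat nexp rexp
  | Seq com com
  | Cond bexp com com
  | While bexp com

record state =
  nats :: "nat \<Rightarrow> nat \<Rightarrow> nat"
  reals :: "nat \<Rightarrow> nat \<Rightarrow> real"

primrec nval :: "state \<Rightarrow> nexp \<Rightarrow> nat" where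
  "nval s (Const c) = c"
| "nval s (NRead a e) = nats s a (nval s e)"
| "nval s (NAdd e f) = nval s e + nval s f"
| "nval s (NSub e f) = nval s e - nval s f"
| "nval s (NMul e f) = nval s e * nval s f"
| "nval s (NDiv e f) = nval s e div nval s f"

definition word_cost :: "nat \<Rightarrow> nat" where
  "word_cost v = 1 + floorlog 2 v"

primrec ntime :: "state \<Rightarrow> nexp \<Rightarrow> nat" where
  "ntime s (Const c) = word_cost c"
| "ntime s (NRead a e) = word_cost (nval s (NRead a e)) + ntime s e"
| "ntime s (NAdd e f) = word_cost (nval s (NAdd e f)) + ntime s e + ntime s f"
| "ntime s (NSub e f) = word_cost (nval s (NSub e f)) + ntime s e + ntime s f"
| "ntime s (NMul e f) = word_cost (nval s (NMul e f)) + ntime s e + ntime s f"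
| "ntime s (NDiv e f) = word_cost (nval s (NDiv e f)) + ntime s e + ntime s f"

text \<open>The parameter \<open>q\<close> below answers distance queries, given by positions of points.\<close>

primrec rval :: "(nat \<Rightarrow> nat \<Rightarrow> real) \<Rightarrow> state \<Rightarrow> rexp \<Rightarrow> real" where
  "rval q s (OfNat e) = real (nval s e)"
| "rval q s (RRead a e) = reals s a (nval s e)"
| "rval q s (Query e f) = q (nval s e) (nval s f)"
| "rval q s (RAdd e f) = rval q s e + rval q s f"
| "rval q s (RSub e f) = rval q s e - rval q s f"
| "rval q s (RMul e f) = rval q s e * rval q s f"

primrec rtime :: "state \<Rightarrow> rexp \<Rightarrow> nat" where
  "rtime s (OfNat e) = 1 + ntime s e"
| "rtime s (RRead a e) = 1 + ntime s e"
| "rtime s (Query e f) = 1 + ntime s e + ntime s f"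
| "rtime s (RAdd e f) = 1 + rtime s e + rtime s f"
| "rtime s (RSub e f) = 1 + rtime s e + rtime s f"
| "rtime s (RMul e f) = 1 + rtime s e + rtime s f"

primrec bval :: "(nat \<Rightarrow> nat \<Rightarrow> real) \<Rightarrow> state \<Rightarrow> bexp \<Rightarrow> bool" where
  "bval q s (NLess e f) \<longleftrightarrow> nval s e < nval s f"
| "bval q s (RLess e f) \<longleftrightarrow> rval q s e < rval q s f"
| "bval q s (Not b) \<longleftrightarrow> \<not> bval q s b"
| "bval q s (And b c) \<longleftrightarrow> bval q s b \<and> bval q s c"

primrec btime :: "state \<Rightarrow> bexp \<Rightarrow> nat" where
  "btime s (NLess e f) = 1 + ntime s e + ntime s f"
| "btime s (RLess e f) = 1 + rtime s e + rtime s f"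
| "btime s (Not b) = 1 + btime s b"
| "btime s (And b c) = 1 + btime s b + btime s c"

definition nstore :: "nat \<Rightarrow> nat \<Rightarrow> nat \<Rightarrow> state \<Rightarrow> state" where
  "nstore a i v s = s\<lparr>nats := (nats s)(a := (nats s a)(i := v))\<rparr>"

definition rstore :: "nat \<Rightarrow> nat \<Rightarrow> real \<Rightarrow> state \<Rightarrow> state" where
  "rstore a i v s = s\<lparr>reals := (reals s)(a := (reals s a)(i := v))\<rparr>"

text \<open>\<open>exec q c s t s'\<close>: with queries answered by \<open>q\<close>, program \<open>c\<close> started in \<open>s\<close> halts in \<open>s'\<close> after time \<open>t\<close>.\<close>

inductive exec :: "(nat \<Rightarrow> nat \<Rightarrow> real) \<Rightarrow> com \<Rightarrow> state \<Rightarrow> nat \<Rightarrow> state \<Rightarrow> bool"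
  for q :: "nat \<Rightarrow> nat \<Rightarrow> real" where
  Skip: "exec q Skip s 1 s"
| NStore: "exec q (NStore a i e) s (1 + ntime s i + ntime s e) (nstore a (nval s i) (nval s e) s)"
| RStore: "exec q (RStore a i e) s (1 + ntime s i + rtime s e) (rstore a (nval s i) (rval q s e) s)"
| Seq: "exec q c1 s t1 s1 \<Longrightarrow> exec q c2 s1 t2 s2 \<Longrightarrow> exec q (Seq c1 c2) s (t1 + t2) s2"
| CondTrue: "bval q s b \<Longrightarrow> exec q c1 s t s' \<Longrightarrow> exec q (Cond b c1 c2) s (1 + btime s b + t) s'"
| CondFalse: "\<not> bval q s b \<Longrightarrow> exec q c2 s t s' \<Longrightarrow> exec q (Cond b c1 c2) s (1 + btime s b + t) s'"
| WhileFalse: "\<not> bval q s b \<Longrightarrow> exec q (While b c) s (1 + btime s b) s"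
| WhileTrue: "bval q s b \<Longrightarrow> exec q c s t1 s1 \<Longrightarrow> exec q (While b c) s1 t2 s2 \<Longrightarrow>
    exec q (While b c) s (1 + btime s b + t1 + t2) s2"

inductive_cases SkipE: "exec q Skip s t s'"
inductive_cases NStoreE: "exec q (NStore a i e) s t s'"
inductive_cases RStoreE: "exec q (RStore a i e) s t s'"
inductive_cases SeqE: "exec q (Seq c1 c2) s t s'"
inductive_cases CondE: "exec q (Cond b c1 c2) s t s'"
inductive_cases WhileE: "exec q (While b c) s t s'"

lemma exec_deterministic:
  assumes "exec q c s t s'" and "exec q c s u s''"
  shows "t = u \<and> s' = s''"
  using assms
proof (induction arbitrary: u s'' rule: exec.induct)
  case (Skip s)
  then show ?case by (auto elim: SkipE)
next
  case (NStore a i e s)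
  then show ?case by (auto elim: NStoreE)
next
  case (RStore a i e s)
  then show ?case by (auto elim: RStoreE)
next
  case (Seq c1 s t1 s1 c2 t2 s2)
  from Seq.prems show ?case by (rule SeqE) (metis Seq.IH)
next
  case (CondTrue s b c1 t s' c2)
  from CondTrue.prems show ?case by (rule CondE) (metis CondTrue.hyps(1) CondTrue.IH plus_1_eq_Suc add_Suc)+
next
  case (CondFalse s b c2 t s' c1)
  from CondFalse.prems show ?case by (rule CondE) (metis CondFalse.hyps(1) CondFalse.IH plus_1_eq_Suc add_Suc)+
next
  case (WhileFalse s b c)
  from WhileFalse.prems show ?case by (rule WhileE) (simp_all add: WhileFalse.hyps)
next
  case (WhileTrue s b c t1 s1 t2 s2)
  from WhileTrue.prems show ?case by (rule WhileE) (metis WhileTrue.hyps(1) WhileTrue.IH plus_1_eq_Suc add_Suc)+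
qed


section \<open>Input and output\<close>

text \<open>
  \<open>vs\<close> enumerates \<open>V\<close>, and \<open>xs\<close> lists the positions in \<open>vs\<close> of the elements of \<open>X\<close>.
  Distances are not part of the memory: they are accessible only through queries.
  All cells not mentioned are initially 0.
\<close>

definition cells :: "'b::zero list \<Rightarrow> nat \<Rightarrow> 'b" where
  "cells bs i = (if i < length bs then bs ! i else 0)"

definition input_state :: "'a list \<Rightarrow> ('a \<Rightarrow> real) \<Rightarrow> nat list \<Rightarrow> nat \<Rightarrow> state" where
  "input_state vs w xs k' =
     \<lparr>nats = (\<lambda>_ _. 0)(0 := cells [length vs, length xs, k'], 1 := cells xs),
      reals = (\<lambda>_ _. 0)(0 := cells (map w vs))\<rparr>"

definition dist_query :: "'a list \<Rightarrow> ('a \<Rightarrow> 'a \<Rightarrow> real) \<Rightarrow> nat \<Rightarrow> nat \<Rightarrow> real" where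
  "dist_query vs d i j = (if i < length vs \<and> j < length vs then d (vs ! i) (vs ! j) else 0)"

text \<open>The answer is left in the first \<open>k'\<close> cells of the natural-number array 2, as positions in \<open>vs\<close>.\<close>

definition returns :: "'a list \<Rightarrow> nat \<Rightarrow> state \<Rightarrow> 'a set \<Rightarrow> bool" where
  "returns vs k' s S \<longleftrightarrow>
     (\<forall>i<k'. nats s 2 i < length vs) \<and> S = (\<lambda>i. vs ! nats s 2 i) ` {..<k'}"

end

theory Submission
  imports Defs
begin

text \<open>
  Reverse greedy: start from \<open>X\<close> and repeatedly discard the center whose removal increases the
  cost least. While \<open>j + k\<close> centers are left, at least \<open>j\<close> of them are not nearest to any optimal
  center; rerouting the points of such a center through their optimal centers shows that the
  removals of these \<open>j\<close> centers increase the cost by at most \<open>2 * OPT\<close> in total, so the cheapest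
  one costs at most \<open>2 * OPT / j\<close>. Summing over \<open>j\<close> gives the logarithm.

  For the running time, every point keeps its nearest center, together with a tournament tree over
  all other remaining centers whose root is the second nearest one. One removal changes one leaf of
  each tree: either the removed center leaves it, or, if the removed center was the nearest one,
  the second nearest center leaves it to become the nearest. The increases caused by the
  removals are then read off the roots in linear time.
\<close>

section \<open>Reverse greedy and the cost of its solutions\<close>

text \<open>The summation over \<open>j\<close> has to work down to \<open>k' = k\<close>, and the
  logarithm is 0 for \<open>k = 1\<close> and \<open>k' = card X\<close>, so no additive constant is
  allowed. Comparing \<open>1 / j\<close> with an integral over \<open>[j - 1, j]\<close> would put
  \<open>k' - k\<close> into the denominator. Each term is therefore charged to
  \<open>[j, j + 1]\<close>; as \<open>j + 1 \<le> 2 * j\<close>, this costs a factor 2, which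
  together with the factor 2 from rerouting gives the constant 4. Searching for second nearest
  centers afresh in every round would cost a further factor \<open>card X\<close>. Trees can replace
  this search because the order of the centers by distance from a fixed point never changes: a
  removal only deletes a contestant. The time bound has two logarithmic factors: one is the length
  of a path in a tree, the other is the bit length charged for operations on naturals. The second
  applies to addresses too, so computed values have to be bounded along with stored ones.\<close>

lemma Min_image_least:
  fixes f :: "'b \<Rightarrow> real"
  assumes "finite A" "c \<in> A" "\<And>p. p \<in> A \<Longrightarrow> f c \<le> f p"
  shows "Min (f ` A) = f c"
  using assms by (intro Min_eqI) auto

section \<open>Distances to a set, the optimum, and a cheap removal\<close>

context weighted_metric_space
begin

lemma dist_set_le: "finite S \<Longrightarrow> y \<in> S \<Longrightarrow> dist_set d x S \<le> d x y"
  by (simp add: dist_set_def)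

lemma dist_set_attained:
  assumes "finite S" "S \<noteq> {}"
  obtains y where "y \<in> S" "dist_set d x S = d x y"
proof -
  have "Min (d x ` S) \<in> d x ` S" using assms by (intro Min_in) auto
  then show thesis using that by (auto simp: dist_set_def)
qed

lemma dist_set_nonneg:
  assumes "S \<subseteq> V" "S \<noteq> {}" "x \<in> V"
  shows "0 \<le> dist_set d x S"
proof -
  have "finite S" using assms(1) finite_space by (rule finite_subset)
  then obtain y where "dist_set d x S = d x y"
    using assms(2) by (rule dist_set_attained)
  then show ?thesis by simp
qed

lemma OPT_attained:
  assumes "k \<le> card V"
  obtains S where "S \<subseteq> V" "card S = k" "cost w d S V = OPT V w d k"
proof -
  let ?C = "{cost w d S V | S. S \<subseteq> V \<and> card S = k}"
  have "?C = (\<lambda>S. cost w d S V) ` {S \<in> Pow V. card S = k}" by auto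
  then have "finite ?C" using finite_space by simp
  moreover have "?C \<noteq> {}"
    by (rule obtain_subset_with_card_n[OF assms]) blast
  ultimately have "OPT V w d k \<in> ?C" unfolding OPT_def by (rule Min_in)
  then obtain S where "S \<subseteq> V" "card S = k" "OPT V w d k = cost w d S V" by blast
  then show thesis by (intro that) simp_all
qed

lemma cost_nonneg:
  assumes "S \<subseteq> V" "S \<noteq> {}"
  shows "0 \<le> cost w d S V"
  unfolding cost_def using assms by (intro sum_nonneg mult_nonneg_nonneg dist_set_nonneg weight_nonneg)

lemma OPT_nonneg:
  assumes "1 \<le> k" "k \<le> card V"
  shows "0 \<le> OPT V w d k"
proof -
  obtain S where S: "S \<subseteq> V" "card S = k" "cost w d S V = OPT V w d k"
    using assms(2) by (rule OPT_attained)
  then have "S \<noteq> {}" using assms(1) by auto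
  then show ?thesis using cost_nonneg[OF S(1)] S(3) by simp
qed

text \<open>A center that is nearest in \<open>S\<close> to no optimal center can be dropped at the price of twice
  the optimal cost of its cluster: reroute each of its points \<open>x\<close> through the optimal center of
  \<open>x\<close>. There are at least \<open>card S - k\<close> such centers, and their clusters are disjoint.\<close>

lemma exists_cheap_removal:
  assumes S: "S \<subseteq> V" and k: "1 \<le> k" "k < card S"
  shows "\<exists>y\<in>S. cost w d (S - {y}) V \<le> cost w d S V + 2 * OPT V w d k / real (card S - k)"
proof -
  have fS: "finite S" using S finite_space by (rule finite_subset)
  have S0: "S \<noteq> {}" using k by auto
  have kV: "k \<le> card V" using k card_mono[OF finite_space S] by simp
  obtain Z where Z: "Z \<subseteq> V" "card Z = k" "cost w d Z V = OPT V w d k"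
    by (rule OPT_attained[OF kV])
  have fZ: "finite Z" using Z finite_space finite_subset by blast
  have Z0: "Z \<noteq> {}" using Z k by auto
  have "\<exists>y. y \<in> S \<and> dist_set d x S = d x y" for x
    by (rule dist_set_attained[OF fS S0, of x]) blast
  then obtain c where c: "\<And>x. c x \<in> S" "\<And>x. dist_set d x S = d x (c x)" by metis
  have "\<exists>z. z \<in> Z \<and> dist_set d x Z = d x z" for x
    by (rule dist_set_attained[OF fZ Z0, of x]) blast
  then obtain z where z: "\<And>x. z x \<in> Z" "\<And>x. dist_set d x Z = d x (z x)" by metis
  define U where "U = S - c ` Z"
  have fU: "finite U" using fS by (simp add: U_def)
  have "card (c ` Z) \<le> k" using card_image_le[OF fZ, of c] Z(2) by simp
  then have cU: "card S - k \<le> card U"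
    using diff_card_le_card_Diff[of "c ` Z" S] fZ unfolding U_def by simp
  have U0: "U \<noteq> {}" using cU k by auto
  define g where "g x = 2 * (w x * dist_set d x Z)" for x
  have g0: "0 \<le> g x" if "x \<in> V" for x
    unfolding g_def using that weight_nonneg dist_set_nonneg[OF Z(1) Z0] by simp
  have drop: "cost w d (S - {y}) V - cost w d S V \<le> (\<Sum>x\<in>{x\<in>V. c x = y}. g x)" if y: "y \<in> U" for y
  proof -
    have "w x * dist_set d x (S - {y}) - w x * dist_set d x S \<le> (if c x = y then g x else 0)"
      if x: "x \<in> V" for x
    proof (cases "c x = y")
      case False
      then have "dist_set d x (S - {y}) \<le> dist_set d x S"
        using c(1)[of x] c(2)[of x] dist_set_le[of "S - {y}" "c x" x] fS by simp
      then show ?thesis using False weight_nonneg[OF x] by (simp add: mult_left_mono)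
    next
      case True
      let ?z = "z x"
      have zV: "?z \<in> V" using z(1) Z(1) by blast
      have cV: "c u \<in> V" for u using c(1) S by blast
      \<comment> \<open>Here it matters that \<open>y\<close> lies outside the image of
        \<open>Z\<close> under \<open>c\<close>: the center nearest to the optimal center
        \<open>?z\<close> is still available.\<close>
      have "c ?z \<in> S - {y}" using y z(1) c(1) unfolding U_def by auto
      then have "dist_set d x (S - {y}) \<le> d x (c ?z)" using fS by (intro dist_set_le) auto
      also have "\<dots> \<le> d x ?z + d ?z (c ?z)" using x zV cV by (intro triangle)
      \<comment> \<open>\<open>c ?z\<close> is nearest to \<open>?z\<close>, hence no farther from
        it than \<open>c x\<close>. The way from \<open>?z\<close> to \<open>c x\<close> leads back
        through \<open>x\<close> and pays the distance to \<open>?z\<close> a second time.\<close>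
      also have "d ?z (c ?z) \<le> d ?z (c x)" using c(2)[of ?z] dist_set_le[OF fS c(1), of ?z x] by simp
      also have "d ?z (c x) \<le> d ?z x + d x (c x)" using x zV cV by (intro triangle)
      also have "d ?z x = d x ?z" by (rule commute)
      finally have "dist_set d x (S - {y}) \<le> dist_set d x S + 2 * dist_set d x Z"
        using c(2)[of x] z(2)[of x] by simp
      then have "w x * dist_set d x (S - {y}) \<le> w x * (dist_set d x S + 2 * dist_set d x Z)"
        using weight_nonneg[OF x] by (rule mult_left_mono)
      then show ?thesis using True by (simp add: g_def algebra_simps)
    qed
    then have "cost w d (S - {y}) V - cost w d S V \<le> (\<Sum>x\<in>V. if c x = y then g x else 0)"
      unfolding cost_def sum_subtractf[symmetric] by (intro sum_mono)
    then show ?thesis using finite_space by (simp add: sum.If_cases Int_def)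
  qed
  have "(\<Sum>y\<in>U. cost w d (S - {y}) V - cost w d S V) \<le> (\<Sum>y\<in>U. \<Sum>x\<in>{x\<in>V. c x = y}. g x)"
    by (intro sum_mono drop)
  also have "\<dots> = (\<Sum>x\<in>{x\<in>V. c x \<in> U}. g x)"
  proof -
    have "(\<Sum>x\<in>{x\<in>V. c x \<in> U}. g x) = (\<Sum>y\<in>U. \<Sum>x\<in>{x\<in>{x\<in>V. c x \<in> U}. c x = y}. g x)"
      using finite_space fU by (intro sum.group[symmetric]) auto
    moreover have "{x\<in>{x\<in>V. c x \<in> U}. c x = y} = {x\<in>V. c x = y}" if "y \<in> U" for y
      using that by blast
    ultimately show ?thesis by simp
  qed
  also have "\<dots> \<le> (\<Sum>x\<in>V. g x)"
    using finite_space g0 by (intro sum_mono2) auto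
  also have "\<dots> = 2 * OPT V w d k"
    unfolding g_def Z(3)[symmetric] cost_def by (simp add: sum_distrib_left)
  finally have tot: "(\<Sum>y\<in>U. cost w d (S - {y}) V - cost w d S V) \<le> 2 * OPT V w d k" .
  have cUp: "0 < card U" using fU U0 by (simp add: card_gt_0_iff)
  \<comment> \<open>Averaging over \<open>U\<close>; only afterwards is \<open>card U\<close>
    replaced by its lower bound \<open>card S - k\<close>.\<close>
  have "\<exists>y\<in>U. cost w d (S - {y}) V - cost w d S V \<le> 2 * OPT V w d k / real (card U)"
  proof (rule ccontr)
    assume "\<not> ?thesis"
    then have "(\<Sum>y\<in>U. 2 * OPT V w d k / real (card U)) < (\<Sum>y\<in>U. cost w d (S - {y}) V - cost w d S V)"
      using fU U0 by (intro sum_strict_mono) auto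
    then show False using tot cUp by simp
  qed
  then obtain y where y: "y \<in> U" "cost w d (S - {y}) V - cost w d S V \<le> 2 * OPT V w d k / real (card U)"
    by blast
  have "2 * OPT V w d k / real (card U) \<le> 2 * OPT V w d k / real (card S - k)"
    using OPT_nonneg[OF k(1) kV] cU k cUp by (intro divide_left_mono) auto
  with y(2) have "cost w d (S - {y}) V - cost w d S V \<le> 2 * OPT V w d k / real (card S - k)"
    by (rule order_trans)
  then have "cost w d (S - {y}) V \<le> cost w d S V + 2 * OPT V w d k / real (card S - k)"
    by (simp only: diff_le_eq add.commute)
  then show ?thesis using y(1) unfolding U_def by blast
qed

end

inductive reverse_greedy :: "('b set \<Rightarrow> real) \<Rightarrow> 'b set \<Rightarrow> 'b set \<Rightarrow> bool" for f X where
  start: "reverse_greedy f X X"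
| remove: "reverse_greedy f X S \<Longrightarrow> y \<in> S \<Longrightarrow> (\<And>z. z \<in> S \<Longrightarrow> f (S - {y}) \<le> f (S - {z})) \<Longrightarrow>
    reverse_greedy f X (S - {y})"

lemma reverse_greedy_subset: "reverse_greedy f X S \<Longrightarrow> S \<subseteq> X"
  by (induction rule: reverse_greedy.induct) auto

text \<open>Follows from \<open>ln u \<le> u - 1\<close> at \<open>u = a / (a + 1)\<close> together
  with \<open>a + 1 \<le> 2 * a\<close>. The right-hand side is the form that telescopes.\<close>

lemma two_divide_le_ln:
  assumes "1 \<le> (a::real)"
  shows "2 / a \<le> 4 * ln ((a + 1) / a)"
proof -
  have "ln (a / (a + 1)) \<le> a / (a + 1) - 1" using assms by (intro ln_le_minus_one) simp
  moreover have "a / (a + 1) - 1 = - (1 / (a + 1))" using assms by (simp add: field_simps)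
  moreover have "ln ((a + 1) / a) = - ln (a / (a + 1))" using assms by (simp add: ln_div)
  ultimately have "1 / (a + 1) \<le> ln ((a + 1) / a)" by linarith
  moreover have "1 / (2 * a) \<le> 1 / (a + 1)" using assms by (intro divide_left_mono) auto
  ultimately show ?thesis by simp
qed

text \<open>The induction uses the numerator \<open>card X - k + 1\<close>: the logarithm is then 0
  at the start, and a removal from a set of size \<open>a + k\<close> contributes exactly the factor
  \<open>(a + 1) / a\<close> inside it. As \<open>1 \<le> k\<close>, the numerator can be enlarged
  to \<open>card X\<close> at the end.\<close>

lemma (in weighted_metric_space) reverse_greedy_cost:
  assumes "reverse_greedy (\<lambda>S. cost w d S V) X S"
    and "X \<subseteq> V" "1 \<le> k" "k \<le> card S"
  shows "cost w d S V \<le> cost w d X V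
    + 4 * ln (real (card X) / (real (card S) - real k + 1)) * OPT V w d k"
proof -
  have fX: "finite X" using assms(2) finite_space by (rule finite_subset)
  have "k \<le> card X" using card_mono[OF fX reverse_greedy_subset[OF assms(1)]] assms(4) by simp
  then have opt: "0 \<le> OPT V w d k"
    using OPT_nonneg[OF assms(3)] card_mono[OF finite_space assms(2)] by simp
  have "cost w d S V \<le> cost w d X V
    + 4 * ln ((real (card X) - real k + 1) / (real (card S) - real k + 1)) * OPT V w d k"
    using assms(1,4)
  proof (induction rule: reverse_greedy.induct)
    case start
    then show ?case by simp
  next
    case (remove S y)
    have SX: "S \<subseteq> X" using remove(1) by (rule reverse_greedy_subset)
    then have S: "S \<subseteq> V" "finite S" using assms(2) finite_subset[OF _ fX] by auto
    have cS: "card S = Suc (card (S - {y}))" using S(2) remove(2) by (rule card.remove)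
    then have kS: "k < card S" using remove.prems by simp
    define a where "a = real (card S) - real k"
    have a1: "1 \<le> a" using kS by (simp add: a_def)
    have aX: "a \<le> real (card X) - real k" using card_mono[OF fX SX] by (simp add: a_def)
    obtain z where z: "z \<in> S" "cost w d (S - {z}) V \<le> cost w d S V + 2 * OPT V w d k / real (card S - k)"
      using exists_cheap_removal[OF S(1) assms(3) kS] by blast
    \<comment> \<open>The greedy choice \<open>y\<close> is compared with the cheap center
      \<open>z\<close>; it may itself be nearest to some optimal center.\<close>
    have "cost w d (S - {y}) V \<le> cost w d S V + 2 / a * OPT V w d k"
      using remove(3)[OF z(1)] z(2) kS by (simp add: a_def of_nat_diff)
    also have "2 / a * OPT V w d k \<le> 4 * ln ((a + 1) / a) * OPT V w d k"
      using two_divide_le_ln[OF a1] opt by (rule mult_right_mono)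
    also have "cost w d S V \<le> cost w d X V + 4 * ln ((real (card X) - real k + 1) / (a + 1)) * OPT V w d k"
      using remove.IH kS by (simp add: a_def)
    finally have "cost w d (S - {y}) V \<le> cost w d X V
      + 4 * (ln ((real (card X) - real k + 1) / (a + 1)) + ln ((a + 1) / a)) * OPT V w d k"
      by (simp add: algebra_simps)
    also have "ln ((real (card X) - real k + 1) / (a + 1)) + ln ((a + 1) / a)
        = ln ((real (card X) - real k + 1) / a)"
      using a1 aX by (simp add: ln_div)
    also have "a = real (card (S - {y})) - real k + 1" using cS by (simp add: a_def)
    finally show ?case .
  qed
  also have "ln ((real (card X) - real k + 1) / (real (card S) - real k + 1))
      \<le> ln (real (card X) / (real (card S) - real k + 1))"
    using assms(3,4) \<open>k \<le> card X\<close> by (subst ln_le_cancel_iff) (auto intro!: divide_right_mono divide_pos_pos)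
  finally show ?thesis using opt by (simp add: mult_right_mono)
qed

lemma (in weighted_metric_space) aspect_ratio_ge_1: "1 \<le> aspect_ratio V d"
proof (cases "nonzero_dists V d = {}")
  case False
  have "nonzero_dists V d \<subseteq> case_prod d ` (V \<times> V)" by (auto simp: nonzero_dists_def)
  then have fin: "finite (nonzero_dists V d)"
    using finite_space by (meson finite_SigmaI finite_imageI finite_subset)
  have "Min (nonzero_dists V d) \<in> nonzero_dists V d" using fin False by (rule Min_in)
  then have "0 < Min (nonzero_dists V d)"
    using nonneg by (auto simp: nonzero_dists_def order_less_le)
  moreover have "Min (nonzero_dists V d) \<le> Max (nonzero_dists V d)"
    using fin False by (meson Max_ge Min_in)
  ultimately show ?thesis using False by (simp add: aspect_ratio_def)
qed (simp add: aspect_ratio_def)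

section \<open>Running times up to syntactic constants\<close>

definition mem_le :: "nat \<Rightarrow> state \<Rightarrow> bool" where
  "mem_le M s \<longleftrightarrow> (\<forall>a i. nats s a i \<le> M)"

text \<open>An exponent \<open>g\<close> such that the value is at most \<open>M ^ g\<close>. A
  constant gets \<open>c\<close> because \<open>c < 2 ^ c\<close>; a sum gets one extra factor
  \<open>M\<close>, since \<open>2 \<le> M\<close> absorbs the doubling; differences and quotients
  never exceed their first operand. Hence addresses are polynomial in \<open>M\<close> although only
  stored values are bounded by \<open>M\<close>.\<close>

primrec ndegree :: "nexp \<Rightarrow> nat" where
  "ndegree (Const c) = c"
| "ndegree (NRead a e) = 1"
| "ndegree (NAdd e f) = ndegree e + ndegree f + 1"
| "ndegree (NSub e f) = ndegree e"
| "ndegree (NMul e f) = ndegree e + ndegree f"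
| "ndegree (NDiv e f) = ndegree e"

lemma nval_le_power:
  assumes "mem_le M s" "2 \<le> M"
  shows "nval s e \<le> M ^ ndegree e"
proof (induction e)
  case (Const c)
  have "c \<le> 2 ^ c" using less_exp[of c] by simp
  also have "\<dots> \<le> M ^ c" using assms(2) by (rule power_mono) simp
  finally show ?case by simp
next
  case (NRead a e)
  then show ?case using assms by (simp add: mem_le_def)
next
  case (NAdd e f)
  have "nval s e + nval s f \<le> M ^ ndegree e + M ^ ndegree f" using NAdd by simp
  also have "\<dots> \<le> M ^ (ndegree e + ndegree f) + M ^ (ndegree e + ndegree f)"
    using assms(2) by (intro add_mono power_increasing) auto
  also have "\<dots> \<le> M * M ^ (ndegree e + ndegree f)" using assms(2) by (simp flip: mult_2)
  finally show ?case by simp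
next
  case (NSub e f)
  then show ?case by simp
next
  case (NMul e f)
  then show ?case by (simp add: power_add mult_mono)
next
  case (NDiv e f)
  then show ?case by (auto intro: order_trans[OF div_le_dividend])
qed

lemma floorlog_mult_le: "floorlog 2 (a * b) \<le> floorlog 2 a + floorlog 2 b"
proof (cases "a = 0 \<or> b = 0")
  case False
  have "a < 2 ^ floorlog 2 a" "b < 2 ^ floorlog 2 b"
    using False floorlog_bounds[of a 2] floorlog_bounds[of b 2] by auto
  then have "a * b < 2 ^ (floorlog 2 a + floorlog 2 b)"
    by (simp add: power_add mult_strict_mono)
  then show ?thesis using floorlog_le_iff[of 2 "a * b" "floorlog 2 a + floorlog 2 b"] by simp
qed (auto simp: floorlog_def)

lemma word_cost_mono: "a \<le> b \<Longrightarrow> word_cost a \<le> word_cost b"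
  by (simp add: word_cost_def floorlog_mono)

lemma word_cost_pos [simp]: "0 < word_cost a"
  by (simp add: word_cost_def)

text \<open>Bit length is subadditive under products. The \<open>2\<close> pays for the bit length
  of \<open>M ^ 0\<close> and for the 1 in \<open>word_cost\<close>.\<close>

lemma word_cost_power_le: "word_cost (M ^ g) \<le> (g + 2) * word_cost M"
proof -
  have "floorlog 2 (M ^ g) \<le> g * floorlog 2 M + 1"
  proof (induction g)
    case 0
    have "floorlog 2 (1::nat) \<le> 1" using floorlog_le_iff[of 2 1 1] by simp
    then show ?case by simp
  next
    case (Suc g)
    then show ?case using floorlog_mult_le[of M "M ^ g"] by simp
  qed
  then show ?thesis by (simp add: word_cost_def)
qed

text \<open>Every node of an expression pays for its own value, whose word cost is at most
  \<open>ndegree + 2\<close> times \<open>word_cost M\<close>. Summed over the syntax tree, this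
  depends on the program text alone.\<close>

primrec ncoeff :: "nexp \<Rightarrow> nat" where
  "ncoeff (Const c) = ndegree (Const c) + 2"
| "ncoeff (NRead a e) = ndegree (NRead a e) + 2 + ncoeff e"
| "ncoeff (NAdd e f) = ndegree (NAdd e f) + 2 + ncoeff e + ncoeff f"
| "ncoeff (NSub e f) = ndegree (NSub e f) + 2 + ncoeff e + ncoeff f"
| "ncoeff (NMul e f) = ndegree (NMul e f) + 2 + ncoeff e + ncoeff f"
| "ncoeff (NDiv e f) = ndegree (NDiv e f) + 2 + ncoeff e + ncoeff f"

primrec rcoeff :: "rexp \<Rightarrow> nat" where
  "rcoeff (OfNat e) = 1 + ncoeff e"
| "rcoeff (RRead a e) = 1 + ncoeff e"
| "rcoeff (Query e f) = 1 + ncoeff e + ncoeff f"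
| "rcoeff (RAdd e f) = 1 + rcoeff e + rcoeff f"
| "rcoeff (RSub e f) = 1 + rcoeff e + rcoeff f"
| "rcoeff (RMul e f) = 1 + rcoeff e + rcoeff f"

primrec bcoeff :: "bexp \<Rightarrow> nat" where
  "bcoeff (NLess e f) = 1 + ncoeff e + ncoeff f"
| "bcoeff (RLess e f) = 1 + rcoeff e + rcoeff f"
| "bcoeff (Not b) = 1 + bcoeff b"
| "bcoeff (And b c) = 1 + bcoeff b + bcoeff c"

primrec ccoeff :: "com \<Rightarrow> nat" where
  "ccoeff Skip = 1"
| "ccoeff (NStore a i e) = 1 + ncoeff i + ncoeff e"
| "ccoeff (RStore a i e) = 1 + ncoeff i + rcoeff e"
| "ccoeff (Seq c1 c2) = ccoeff c1 + ccoeff c2"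
| "ccoeff (Cond b c1 c2) = 1 + bcoeff b + ccoeff c1 + ccoeff c2"
| "ccoeff (While b c) = 1 + bcoeff b + ccoeff c"

lemma ntime_le:
  assumes "mem_le M s" "2 \<le> M"
  shows "ntime s e \<le> ncoeff e * word_cost M"
proof -
  have w: "word_cost (nval s f) \<le> (ndegree f + 2) * word_cost M" for f
    using word_cost_mono[OF nval_le_power[OF assms, of f]] word_cost_power_le[of M "ndegree f"]
    by linarith
  show ?thesis
  proof (induction e)
    case (Const c) show ?case using w[of "Const c"] by simp
  next
    case (NRead a e) then show ?case using w[of "NRead a e"] by (simp add: algebra_simps)
  next
    case (NAdd e f) then show ?case using w[of "NAdd e f"] by (simp add: algebra_simps)
  next
    case (NSub e f) then show ?case using w[of "NSub e f"] by (simp add: algebra_simps)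
  next
    case (NMul e f) then show ?case using w[of "NMul e f"] by (simp add: algebra_simps)
  next
    case (NDiv e f) then show ?case using w[of "NDiv e f"] by (simp add: algebra_simps)
  qed
qed

lemma rtime_le:
  assumes "mem_le M s" "2 \<le> M"
  shows "rtime s e \<le> rcoeff e * word_cost M"
proof -
  note n = ntime_le[OF assms]
  have "1 \<le> word_cost M" by (simp add: word_cost_def)
  then show ?thesis
  proof (induction e)
    case (OfNat e) then show ?case using n[of e] by (simp add: algebra_simps)
  next
    case (RRead a e) then show ?case using n[of e] by (simp add: algebra_simps)
  next
    case (Query e f) then show ?case using n[of e] n[of f] by (simp add: algebra_simps)
  qed (simp_all add: algebra_simps)
qed

lemma btime_le:
  assumes "mem_le M s" "2 \<le> M"
  shows "btime s b \<le> bcoeff b * word_cost M"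
proof -
  note n = ntime_le[OF assms] and r = rtime_le[OF assms]
  have "1 \<le> word_cost M" by (simp add: word_cost_def)
  then show ?thesis
  proof (induction b)
    case (NLess e f) then show ?case using n[of e] n[of f] by (simp add: algebra_simps)
  next
    case (RLess e f) then show ?case using r[of e] r[of f] by (simp add: algebra_simps)
  qed (simp_all add: algebra_simps)
qed

text \<open>Charging every command in proportion to its syntactic constant \<open>ccoeff\<close> keeps explicit
  constants out of all time bounds: only the number of repetitions \<open>F\<close> has to be tracked.\<close>

definition wp :: "(nat \<Rightarrow> nat \<Rightarrow> real) \<Rightarrow> nat \<Rightarrow> nat \<Rightarrow> com \<Rightarrow> (state \<Rightarrow> bool) \<Rightarrow> state \<Rightarrow> bool" where
  "wp q M F c Q s \<longleftrightarrow> 2 \<le> M \<and> mem_le M s \<longrightarrow>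
     (\<exists>t s'. exec q c s t s' \<and> t \<le> ccoeff c * (F * word_cost M) \<and> mem_le M s' \<and> Q s')"

section \<open>Proof rules for halting within a budget\<close>

lemma wp_mono:
  assumes "wp q M F c Q s" "F \<le> G" "\<And>s'. mem_le M s' \<Longrightarrow> Q s' \<Longrightarrow> R s'"
  shows "wp q M G c R s"
  unfolding wp_def
proof
  assume "2 \<le> M \<and> mem_le M s"
  then obtain t s' where e: "exec q c s t s'" "t \<le> ccoeff c * (F * word_cost M)" "mem_le M s'" "Q s'"
    using assms(1) unfolding wp_def by blast
  have "ccoeff c * (F * word_cost M) \<le> ccoeff c * (G * word_cost M)"
    using assms(2) by (intro mult_le_mono) auto
  then show "\<exists>t s'. exec q c s t s' \<and> t \<le> ccoeff c * (G * word_cost M) \<and> mem_le M s' \<and> R s'"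
    using e assms(3) by (metis order_trans)
qed

lemma word_cost_le_factor: "0 < F \<Longrightarrow> word_cost M \<le> F * word_cost M"
  by simp

lemma wp_Skip:
  assumes "0 < F" "Q s"
  shows "wp q M F Skip Q s"
  unfolding wp_def
proof
  assume "2 \<le> M \<and> mem_le M s"
  moreover have "1 \<le> F * word_cost M" using assms(1) by (simp add: Suc_le_eq)
  ultimately show "\<exists>t s'. exec q Skip s t s' \<and> t \<le> ccoeff Skip * (F * word_cost M) \<and> mem_le M s' \<and> Q s'"
    using assms exec.Skip[of q s] by (intro exI[of _ 1] exI[of _ s]) auto
qed

lemma wp_NStore:
  assumes "0 < F" "nval s e \<le> M" "Q (nstore a (nval s i) (nval s e) s)"
  shows "wp q M F (NStore a i e) Q s"
  unfolding wp_def
proof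
  assume m: "2 \<le> M \<and> mem_le M s"
  let ?t = "1 + ntime s i + ntime s e" and ?B = "ccoeff (NStore a i e) * (F * word_cost M)"
  have "?t \<le> (1 + ncoeff i + ncoeff e) * word_cost M"
    using ntime_le[of M s i] ntime_le[of M s e] word_cost_pos[of M] m
    by (simp add: algebra_simps del: word_cost_pos)
  also have "\<dots> \<le> ?B"
    using word_cost_le_factor[OF assms(1)] by (simp only: ccoeff.simps mult_le_mono2)
  finally have "?t \<le> ?B" .
  moreover have "mem_le M (nstore a (nval s i) (nval s e) s)"
    using m assms(2) by (auto simp: mem_le_def nstore_def)
  ultimately show "\<exists>t s'. exec q (NStore a i e) s t s' \<and> t \<le> ccoeff (NStore a i e) * (F * word_cost M)
      \<and> mem_le M s' \<and> Q s'"
    using assms(3) exec.NStore[of q a i e s] by blast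
qed

lemma wp_RStore:
  assumes "0 < F" "Q (rstore a (nval s i) (rval q s e) s)"
  shows "wp q M F (RStore a i e) Q s"
  unfolding wp_def
proof
  assume m: "2 \<le> M \<and> mem_le M s"
  let ?t = "1 + ntime s i + rtime s e" and ?B = "ccoeff (RStore a i e) * (F * word_cost M)"
  have "?t \<le> (1 + ncoeff i + rcoeff e) * word_cost M"
    using ntime_le[of M s i] rtime_le[of M s e] word_cost_pos[of M] m
    by (simp add: algebra_simps del: word_cost_pos)
  also have "\<dots> \<le> ?B"
    using word_cost_le_factor[OF assms(1)] by (simp only: ccoeff.simps mult_le_mono2)
  finally have "?t \<le> ?B" .
  moreover have "mem_le M (rstore a (nval s i) (rval q s e) s)"
    using m by (auto simp: mem_le_def rstore_def)
  ultimately show "\<exists>t s'. exec q (RStore a i e) s t s' \<and> t \<le> ccoeff (RStore a i e) * (F * word_cost M)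
      \<and> mem_le M s' \<and> Q s'"
    using assms(2) exec.RStore[of q a i e s] by blast
qed

text \<open>Both parts get the same factor \<open>F\<close>, because \<open>ccoeff\<close> adds the
  coefficients of the parts; consecutive loops share one budget instead of adding theirs.\<close>

lemma wp_Seq:
  assumes "wp q M F c1 (\<lambda>s'. wp q M F c2 Q s') s"
  shows "wp q M F (Seq c1 c2) Q s"
  unfolding wp_def
proof
  assume m: "2 \<le> M \<and> mem_le M s"
  then obtain t1 s1 where 1: "exec q c1 s t1 s1" "t1 \<le> ccoeff c1 * (F * word_cost M)"
      "mem_le M s1" "wp q M F c2 Q s1"
    using assms unfolding wp_def[of _ _ _ c1] by blast
  then obtain t2 s2 where 2: "exec q c2 s1 t2 s2" "t2 \<le> ccoeff c2 * (F * word_cost M)"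
      "mem_le M s2" "Q s2"
    using m unfolding wp_def by blast
  have "t1 + t2 \<le> ccoeff (Seq c1 c2) * (F * word_cost M)"
    using 1(2) 2(2) by (simp add: add_mult_distrib)
  then show "\<exists>t s'. exec q (Seq c1 c2) s t s' \<and> t \<le> ccoeff (Seq c1 c2) * (F * word_cost M)
      \<and> mem_le M s' \<and> Q s'"
    using exec.Seq[OF 1(1) 2(1)] 2(3,4) by blast
qed

lemma wp_Cond:
  assumes "0 < F" "bval q s b \<Longrightarrow> wp q M F c1 Q s" "\<not> bval q s b \<Longrightarrow> wp q M F c2 Q s"
  shows "wp q M F (Cond b c1 c2) Q s"
  unfolding wp_def
proof
  assume m: "2 \<le> M \<and> mem_le M s"
  let ?X = "F * word_cost M"
  have X: "word_cost M \<le> ?X" by (rule word_cost_le_factor[OF assms(1)])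
  have "1 + btime s b \<le> (1 + bcoeff b) * word_cost M"
    using btime_le[of M s b] word_cost_pos[of M] m
    by (simp add: algebra_simps del: word_cost_pos)
  also have "\<dots> \<le> (1 + bcoeff b) * ?X" using X by (rule mult_le_mono2)
  finally have b: "1 + btime s b \<le> (1 + bcoeff b) * ?X" .
  show "\<exists>t s'. exec q (Cond b c1 c2) s t s' \<and> t \<le> ccoeff (Cond b c1 c2) * ?X \<and> mem_le M s' \<and> Q s'"
  proof (cases "bval q s b")
    case True
    then obtain t s' where 1: "exec q c1 s t s'" "t \<le> ccoeff c1 * ?X" "mem_le M s'" "Q s'"
      using assms(2) m unfolding wp_def by blast
    have "1 + btime s b + t \<le> ccoeff (Cond b c1 c2) * ?X"
      using b 1(2) by (simp add: add_mult_distrib)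
    then show ?thesis using exec.CondTrue[OF True 1(1)] 1(3,4) by blast
  next
    case False
    then obtain t s' where 1: "exec q c2 s t s'" "t \<le> ccoeff c2 * ?X" "mem_le M s'" "Q s'"
      using assms(3) m unfolding wp_def by blast
    have "1 + btime s b + t \<le> ccoeff (Cond b c1 c2) * ?X"
      using b 1(2) by (simp add: add_mult_distrib)
    then show ?thesis using exec.CondFalse[OF False 1(1)] 1(3,4) by blast
  qed
qed

text \<open>\<open>F\<close> is the budget of one pass and \<open>f\<close> a decreasing measure.
  There are at most \<open>f s\<close> passes; the extra unit in \<open>Suc (f s)\<close> pays for
  the test that ends the loop.\<close>

lemma wp_While:
  assumes F: "0 < F"
    and step: "\<And>s. I s \<Longrightarrow> bval q s b \<Longrightarrow> mem_le M s \<Longrightarrow> wp q M F c (\<lambda>s'. I s' \<and> f s' < f s) s"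
    and post: "\<And>s'. I s' \<Longrightarrow> \<not> bval q s' b \<Longrightarrow> Q s'"
    and init: "I s"
  shows "wp q M (Suc (f s) * F) (While b c) Q s"
  unfolding wp_def
proof
  let ?X = "F * word_cost M" and ?k = "ccoeff (While b c)"
  assume "2 \<le> M \<and> mem_le M s"
  then show "\<exists>t s'. exec q (While b c) s t s' \<and> t \<le> ?k * (Suc (f s) * F * word_cost M) \<and> mem_le M s' \<and> Q s'"
    using init
  proof (induction "f s" arbitrary: s rule: less_induct)
    case less
    have X: "word_cost M \<le> ?X" by (rule word_cost_le_factor[OF F])
    have "1 + btime s b \<le> (1 + bcoeff b) * word_cost M"
      using btime_le[of M s b] word_cost_pos[of M] less
      by (simp add: algebra_simps del: word_cost_pos)
    also have "\<dots> \<le> (1 + bcoeff b) * ?X" using X by (rule mult_le_mono2)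
    finally have b: "1 + btime s b \<le> (1 + bcoeff b) * ?X" .
    show ?case
    proof (cases "bval q s b")
      case True
      then obtain t1 s1 where 1: "exec q c s t1 s1" "t1 \<le> ccoeff c * ?X" "mem_le M s1" "I s1" "f s1 < f s"
        using step[of s] less(2,3) unfolding wp_def by blast
      then obtain t2 s2 where 2: "exec q (While b c) s1 t2 s2"
          "t2 \<le> ?k * (Suc (f s1) * F * word_cost M)" "mem_le M s2" "Q s2"
        using less by blast
      \<comment> \<open>\<open>f s1 < f s\<close> leaves one share of the budget free, which pays
        for the pass just made.\<close>
      note 2(2)
      also have "?k * (Suc (f s1) * F * word_cost M) \<le> ?k * (f s * F * word_cost M)"
        using 1(5) by (intro mult_le_mono) auto
      finally have "1 + btime s b + t1 + t2 \<le> (1 + bcoeff b) * ?X + ccoeff c * ?X + ?k * (f s * F * word_cost M)"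
        using b 1(2) by linarith
      also have "\<dots> = ?k * (Suc (f s) * F * word_cost M)" by (simp add: algebra_simps)
      finally show ?thesis using exec.WhileTrue[OF True 1(1) 2(1)] 2(3,4) by blast
    next
      case False
      have "(1 + bcoeff b) * ?X \<le> ?k * (Suc (f s) * F * word_cost M)"
        by (intro mult_le_mono) auto
      with b have "1 + btime s b \<le> ?k * (Suc (f s) * F * word_cost M)" by linarith
      then show ?thesis using exec.WhileFalse[OF False] less(2,3) post[OF _ False] by blast
    qed
  qed
qed

lemma nats_nstore [simp]: "nats (nstore a i v s) = (nats s)(a := (nats s a)(i := v))"
  and reals_nstore [simp]: "reals (nstore a i v s) = reals s"
  and nats_rstore [simp]: "nats (rstore a i x s) = nats s"
  and reals_rstore [simp]: "reals (rstore a i x s) = (reals s)(a := (reals s a)(i := x))"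
  by (simp_all add: nstore_def rstore_def)

abbreviation Var :: "nat \<Rightarrow> nexp" where
  "Var a \<equiv> NRead a (Const 0)"

definition For :: "nat \<Rightarrow> nexp \<Rightarrow> com \<Rightarrow> com" where
  "For a e c = Seq (NStore a (Const 0) (Const 0))
     (While (NLess (Var a) e) (Seq c (NStore a (Const 0) (NAdd (Var a) (Const 1)))))"

text \<open>\<open>I i\<close> describes the state after the counter has been set to
  \<open>i\<close>, hence the \<open>nstore\<close> in the premises. The body has to preserve the
  counter, and \<open>N \<le> M\<close> keeps all its values storable.\<close>

lemma wp_For:
  assumes F: "0 < F" and N: "N \<le> M"
    and e: "\<And>i s. I i s \<Longrightarrow> nval s e = N"
    and init: "I 0 (nstore a 0 0 s)"
    and step: "\<And>i s. i < N \<Longrightarrow> I i s \<Longrightarrow> nats s a 0 = i \<Longrightarrow> mem_le M s \<Longrightarrow>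
      wp q M F c (\<lambda>s'. nats s' a 0 = i \<and> I (Suc i) (nstore a 0 (Suc i) s')) s"
    and post: "\<And>s'. I N s' \<Longrightarrow> Q s'"
  shows "wp q M (Suc N * F) (For a e c) Q s"
proof -
  define J where "J s \<longleftrightarrow> I (nats s a 0) s \<and> nats s a 0 \<le> N" for s
  have "wp q M (Suc (N - nats (nstore a 0 0 s) a 0) * F)
      (While (NLess (Var a) e) (Seq c (NStore a (Const 0) (NAdd (Var a) (Const 1))))) Q (nstore a 0 0 s)"
  proof (rule wp_While[where I = J, OF F])
    fix s assume J: "J s" and b: "bval q s (NLess (Var a) e)" and m: "mem_le M s"
    let ?i = "nats s a 0"
    have i: "?i < N" and I: "I ?i s" using J b e[of ?i s] by (auto simp: J_def)
    show "wp q M F (Seq c (NStore a (Const 0) (NAdd (Var a) (Const 1))))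
        (\<lambda>s'. J s' \<and> N - nats s' a 0 < N - nats s a 0) s"
    proof (rule wp_Seq, rule wp_mono[OF step[OF i I refl m] order_refl])
      fix s' assume s': "nats s' a 0 = ?i \<and> I (Suc ?i) (nstore a 0 (Suc ?i) s')"
      show "wp q M F (NStore a (Const 0) (NAdd (Var a) (Const 1)))
          (\<lambda>s''. J s'' \<and> N - nats s'' a 0 < N - nats s a 0) s'"
        using s' i N F by (intro wp_NStore) (auto simp: J_def)
    qed
  next
    fix s' assume "J s'" "\<not> bval q s' (NLess (Var a) e)"
    then have "I N s'" using e[of "nats s' a 0" s'] by (auto simp: J_def)
    then show "Q s'" by (rule post)
  next
    show "J (nstore a 0 0 s)" using init by (simp add: J_def)
  qed
  then show ?thesis unfolding For_def using F by (intro wp_Seq wp_NStore) simp_all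
qed

section \<open>Tournament trees and the program\<close>

text \<open>\<open>b\<close> wins if it is present and \<open>a\<close> is absent or strictly
  farther away. The condition is built from negations and conjunctions because \<open>bexp\<close>
  has no other connectives, and so matches the test in \<open>climb_body\<close>.\<close>

definition duel :: "(nat \<Rightarrow> real) \<Rightarrow> nat \<Rightarrow> nat \<Rightarrow> nat" where
  "duel \<delta> a b = (if 0 < b \<and> \<not> (0 < a \<and> \<not> \<delta> b < \<delta> a) then b else a)"

text \<open>Heap-style numbering: node \<open>j\<close> has the children \<open>2 * j\<close> and \<open>2 * j + 1\<close>, and the leaf of the
  contestant \<open>z \<in> {1..m}\<close> is the node \<open>m + z - 1\<close>. The value 0 stands for an absent contestant.\<close>

definition tournament :: "(nat \<Rightarrow> real) \<Rightarrow> nat \<Rightarrow> nat set \<Rightarrow> (nat \<Rightarrow> nat) \<Rightarrow> bool" where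
  "tournament \<delta> m A f \<longleftrightarrow>
     (\<forall>z\<in>{1..m}. f (m + z - 1) = (if z \<in> A then z else 0)) \<and>
     (\<forall>j\<in>{1..<m}. f j = duel \<delta> (f (2 * j)) (f (2 * j + 1)))"

lemma tournament_cong:
  assumes "\<And>j. j < 2 * m \<Longrightarrow> f j = g j"
  shows "tournament \<delta> m A f \<longleftrightarrow> tournament \<delta> m A g"
  unfolding tournament_def using assms by (intro conj_cong ball_cong) auto

text \<open>\<open>beats\<close> holds between a parent and each of its children and is transitive,
  so the root beats every leaf. All that enters is that the parent of a node below
  \<open>2 * m\<close> is an inner node, so this works for every \<open>m\<close>, not only for
  powers of 2.\<close>

lemma tournament_root:
  assumes T: "tournament \<delta> m A f" and A: "A \<subseteq> {1..m}" "A \<noteq> {}"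
  shows "f 1 \<in> A" "\<And>z. z \<in> A \<Longrightarrow> \<delta> (f 1) \<le> \<delta> z"
proof -
  define beats where "beats a b \<longleftrightarrow> 0 < b \<longrightarrow> 0 < a \<and> \<delta> a \<le> \<delta> b" for a b :: nat
  have leaf: "f (m + z - 1) = (if z \<in> A then z else 0)" if "z \<in> {1..m}" for z
    using T that by (auto simp: tournament_def)
  have node: "f j = duel \<delta> (f (2 * j)) (f (2 * j + 1))" if "1 \<le> j" "j < m" for j
    using T that by (auto simp: tournament_def)
  have up: "beats (f (j div 2)) (f j)" if "2 \<le> j" "j < 2 * m" for j
  proof -
    have "beats (duel \<delta> a b) a" "beats (duel \<delta> a b) b" for a b
      by (auto simp: beats_def duel_def)
    moreover have "f (j div 2) = duel \<delta> (f (2 * (j div 2))) (f (2 * (j div 2) + 1))"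
      using that by (intro node) auto
    moreover have "j = 2 * (j div 2) \<or> j = 2 * (j div 2) + 1" by presburger
    ultimately show ?thesis by metis
  qed
  have root: "beats (f 1) (f j)" if "1 \<le> j" "j < 2 * m" for j
    using that
  proof (induction j rule: less_induct)
    case (less j)
    show ?case
    proof (cases "j = 1")
      case False
      then have "beats (f 1) (f (j div 2))" using less.prems by (intro less.IH) auto
      moreover have "beats (f (j div 2)) (f j)" using False less.prems by (intro up) auto
      ultimately show ?thesis by (auto simp: beats_def)
    qed (simp add: beats_def)
  qed
  \<comment> \<open>This induction runs from the leaves to the root, since the value of an inner
    node comes from its children, which have larger numbers.\<close>
  have val: "f j \<in> insert 0 A" if "1 \<le> j" "j < 2 * m" for j
    using that
  proof (induction "2 * m - j" arbitrary: j rule: less_induct)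
    case less
    show ?case
    proof (cases "j < m")
      case True
      have "f (2 * j) \<in> insert 0 A" "f (2 * j + 1) \<in> insert 0 A"
        using True less.prems by (intro less.hyps; simp)+
      moreover have "duel \<delta> a b = a \<or> duel \<delta> a b = b" for a b by (simp add: duel_def)
      ultimately show ?thesis using node[OF less.prems(1) True] by metis
    next
      case False
      then show ?thesis using leaf[of "Suc j - m"] less.prems by (auto simp: Suc_le_eq)
    qed
  qed
  have main: "0 < f 1 \<and> \<delta> (f 1) \<le> \<delta> z" if z: "z \<in> A" for z
  proof -
    have "1 \<le> z" "z \<le> m" using z A(1) by auto
    then show ?thesis using root[of "m + z - 1"] leaf[of z] z by (auto simp: beats_def)
  qed
  obtain z where "z \<in> A" using A(2) by blast
  moreover from this have "1 \<le> m" using A(1) by auto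
  ultimately show "f 1 \<in> A" using val[of 1] main[of z] by auto
  show "\<delta> (f 1) \<le> \<delta> z" if "z \<in> A" for z using main[OF that] by simp
qed

text \<open>The programs below use the arrays 0, 1, 2 for input and output, and further:
  the naturals 3 for the tournament trees (one row of \<open>2 * m\<close> cells per point), 4 for the nearest
  center of each point, 5 to flag removed centers, and the registers 6 (current point),
  7 (current tree node), 8 (loop counter), 9 (round), 10 (center to be removed), 11 (contestant
  whose leaf changes), 12 (output counter); the reals 1 for the cost increase caused by the removal
  of each center. Centers are numbered from 1, so that 0 can mean "none".\<close>

abbreviation n_points :: nexp where "n_points \<equiv> NRead 0 (Const 0)"
abbreviation n_centers :: nexp where "n_centers \<equiv> NRead 0 (Const 1)"
abbreviation n_output :: nexp where "n_output \<equiv> NRead 0 (Const 2)"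

abbreviation tree_cell :: "nexp \<Rightarrow> nexp" where
  "tree_cell e \<equiv> NAdd (NMul (Var 6) (NMul (Const 2) n_centers)) e"

abbreviation center_dist :: "nexp \<Rightarrow> rexp" where
  "center_dist z \<equiv> Query (Var 6) (NRead 1 (NSub z (Const 1)))"

abbreviation left_child :: nexp where
  "left_child \<equiv> NRead 3 (tree_cell (NMul (Const 2) (Var 7)))"

abbreviation right_child :: nexp where
  "right_child \<equiv> NRead 3 (tree_cell (NAdd (NMul (Const 2) (Var 7)) (Const 1)))"

abbreviation tree_root :: nexp where
  "tree_root \<equiv> NRead 3 (tree_cell (Const 1))"

section \<open>Tree updates and greedy rounds as programs\<close>

definition climb_body :: com where
  "climb_body =
     Seq (NStore 7 (Const 0) (NDiv (Var 7) (Const 2)))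
       (Cond (And (NLess (Const 0) right_child)
           (Not (And (NLess (Const 0) left_child)
             (Not (RLess (center_dist right_child) (center_dist left_child))))))
         (NStore 3 (tree_cell (Var 7)) right_child)
         (NStore 3 (tree_cell (Var 7)) left_child))"

text \<open>Only the ancestors of a leaf depend on it, so recomputing the path to the root repairs
  the tree. Note that \<open>v\<close> is evaluated after register 7 has been set.\<close>

definition set_leaf :: "nexp \<Rightarrow> com" where
  "set_leaf v =
     Seq (NStore 7 (Const 0) (NSub (NAdd n_centers (Var 11)) (Const 1)))
       (Seq (NStore 3 (tree_cell (Var 7)) v)
         (While (NLess (Const 1) (Var 7)) climb_body))"

text \<open>An all-zero row is already the tree without contestants, so a tree is built by inserting
  the centers one at a time with the same update that later serves for removals.\<close>

definition init_point :: com where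
  "init_point =
     Seq (For 8 n_centers (Seq (NStore 11 (Const 0) (NAdd (Var 8) (Const 1))) (set_leaf (Var 11))))
       (Seq (NStore 4 (Var 6) tree_root)
         (Seq (NStore 11 (Const 0) (NRead 4 (Var 6))) (set_leaf (Const 0))))"

text \<open>Removing \<open>z\<close> affects only the points whose nearest center is
  \<open>z\<close>. Each point thus contributes to a single entry, and one pass over the points
  yields the losses of all centers.\<close>

definition compute_losses :: com where
  "compute_losses =
     Seq (For 8 n_centers (RStore 1 (NAdd (Var 8) (Const 1)) (OfNat (Const 0))))
       (For 6 n_points (RStore 1 (NRead 4 (Var 6))
         (RAdd (RRead 1 (NRead 4 (Var 6)))
           (RMul (RRead 0 (Var 6)) (RSub (center_dist tree_root) (center_dist (NRead 4 (Var 6))))))))"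

definition select_center :: com where
  "select_center =
     Seq (NStore 10 (Const 0) (Const 0))
       (For 8 n_centers
         (Cond (And (NLess (NRead 5 (NAdd (Var 8) (Const 1))) (Const 1))
             (Not (And (NLess (Const 0) (Var 10))
               (Not (RLess (RRead 1 (NAdd (Var 8) (Const 1))) (RRead 1 (Var 10)))))))
           (NStore 10 (Const 0) (NAdd (Var 8) (Const 1)))
           Skip))"

text \<open>If the nearest center of the point is removed, its leaf is already empty, and the
  contestant to delete is the former root. Equality of naturals is expressed by two negated
  comparisons.\<close>

definition update_point :: com where
  "update_point =
     Seq (NStore 11 (Const 0) (Var 10))
       (Seq (Cond (And (Not (NLess (NRead 4 (Var 6)) (Var 10))) (Not (NLess (Var 10) (NRead 4 (Var 6)))))
           (Seq (NStore 4 (Var 6) tree_root) (NStore 11 (Const 0) tree_root))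
           Skip)
         (set_leaf (Const 0)))"

definition remove_center :: com where
  "remove_center = Seq (NStore 5 (Var 10) (Const 1)) (For 6 n_points update_point)"

definition write_output :: com where
  "write_output =
     Seq (NStore 12 (Const 0) (Const 0))
       (For 8 n_centers
         (Cond (NLess (NRead 5 (NAdd (Var 8) (Const 1))) (Const 1))
           (Seq (NStore 2 (Var 12) (NRead 1 (Var 8)))
             (NStore 12 (Const 0) (NAdd (Var 12) (Const 1))))
           Skip))"

definition reverse_greedy_program :: com where
  "reverse_greedy_program =
     Seq (For 6 n_points init_point)
       (Seq (For 9 (NSub n_centers n_output) (Seq compute_losses (Seq select_center remove_center)))
         write_output)"

section \<open>Replacing one leaf of a tree\<close>

definition tree_row :: "nat \<Rightarrow> state \<Rightarrow> nat \<Rightarrow> nat \<Rightarrow> nat" where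
  "tree_row m s i j = nats s 3 (i * (2 * m) + j)"

lemma tree_address_inject:
  fixes m :: nat
  assumes "j < 2 * m" "j' < 2 * m"
  shows "i * (2 * m) + j = i' * (2 * m) + j' \<longleftrightarrow> i = i' \<and> j = j'"
proof
  assume eq: "i * (2 * m) + j = i' * (2 * m) + j'"
  have "(i * (2 * m) + j) div (2 * m) = i" "(i' * (2 * m) + j') div (2 * m) = i'"
    using assms by auto
  with eq have "i = i'" by metis
  with eq show "i = i' \<and> j = j'" by simp
qed simp

lemma tree_row_nstore:
  assumes "j < 2 * m" "j' < 2 * m"
  shows "tree_row m (nstore 3 (i * (2 * m) + j) v s) i' j' =
    (if i' = i \<and> j' = j then v else tree_row m s i' j')"
  using tree_address_inject[OF assms(2,1), of i' i] by (auto simp: tree_row_def)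

lemma tree_row_nstore_other [simp]: "a \<noteq> 3 \<Longrightarrow> tree_row m (nstore a i v s) = tree_row m s"
  by (intro ext) (simp add: tree_row_def)

text \<open>These are the nodes whose values may be outdated when the repair of a tree has reached
  \<open>j\<close>. The number 0 satisfies the predicate as well, but nodes are numbered from
  1.\<close>

definition ancestor :: "nat \<Rightarrow> nat \<Rightarrow> bool" where
  "ancestor i j \<longleftrightarrow> (\<exists>e\<ge>1. i = j div 2 ^ e)"

lemma ancestor_half: "ancestor i j \<longleftrightarrow> i = j div 2 \<or> ancestor i (j div 2)"
proof
  assume "ancestor i j"
  then obtain e where e: "e \<ge> 1" "i = j div 2 ^ e" by (auto simp: ancestor_def)
  show "i = j div 2 \<or> ancestor i (j div 2)"
  proof (cases "e = 1")
    case False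
    then have "e - 1 \<ge> 1" "i = j div 2 div 2 ^ (e - 1)"
      using e by (auto simp: div_mult2_eq[symmetric] power_Suc[symmetric] simp del: power_Suc)
    then show ?thesis by (auto simp: ancestor_def)
  qed (use e in simp)
next
  assume "i = j div 2 \<or> ancestor i (j div 2)"
  then show "ancestor i j"
  proof
    assume "i = j div 2"
    then show ?thesis by (auto simp: ancestor_def intro!: exI[of _ 1])
  next
    assume "ancestor i (j div 2)"
    then obtain e where "e \<ge> 1" "i = j div 2 div 2 ^ e" by (auto simp: ancestor_def)
    then show ?thesis by (auto simp: ancestor_def div_mult2_eq[symmetric] intro!: exI[of _ "Suc e"])
  qed
qed

lemma not_ancestor_1: "1 \<le> l \<Longrightarrow> \<not> ancestor l 1"
proof
  assume l: "1 \<le> l" and "ancestor l 1"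
  then obtain e where e: "1 \<le> e" "l = 1 div 2 ^ e" by (auto simp: ancestor_def)
  have "(1::nat) < 2 ^ e" using e(1) by (intro one_less_power) auto
  then have "l = 0" using e(2) by (simp only: div_less)
  then show False using l by simp
qed

text \<open>The trees for \<open>A\<close> and \<open>B\<close> differ in the leaf of
  \<open>z\<close> only. While the loop stands at a node, all inner nodes except its proper
  ancestors agree with their children; at the root no exception is left. Each step shortens the node
  number by one bit, so \<open>word_cost M\<close> bounds the number of tests.\<close>

lemma wp_set_leaf:
  fixes q s i z m M
  defines "\<delta> \<equiv> \<lambda>z. q i (nats s 1 (z - 1))"
  assumes s: "nats s 0 1 = m" "nats s 6 0 = i" "nats s 11 0 = z"
    and z: "1 \<le> z" "z \<le> m" and M: "2 * m \<le> M"
    and T: "tournament \<delta> m A (tree_row m s i)"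
    and v: "\<And>x. nval (nstore 7 0 x s) v = (if z \<in> B then z else 0)"
    and AB: "A - {z} = B - {z}"
    and post: "\<And>s'. reals s' = reals s \<Longrightarrow> (\<And>a. a \<noteq> 3 \<Longrightarrow> a \<noteq> 7 \<Longrightarrow> nats s' a = nats s a) \<Longrightarrow>
      (\<And>i' j. i' \<noteq> i \<Longrightarrow> j < 2 * m \<Longrightarrow> tree_row m s' i' j = tree_row m s i' j) \<Longrightarrow>
      tournament \<delta> m B (tree_row m s' i) \<Longrightarrow> Q s'"
    and F: "word_cost M \<le> F"
  shows "wp q M F (set_leaf v) Q s"
proof -
  define I where "I s' \<longleftrightarrow> reals s' = reals s \<and> (\<forall>a. a \<noteq> 3 \<and> a \<noteq> 7 \<longrightarrow> nats s' a = nats s a) \<and>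
    (\<forall>i' j. i' \<noteq> i \<and> j < 2 * m \<longrightarrow> tree_row m s' i' j = tree_row m s i' j) \<and>
    1 \<le> nats s' 7 0 \<and> nats s' 7 0 < 2 * m \<and>
    (\<forall>x\<in>{1..m}. tree_row m s' i (m + x - 1) = (if x \<in> B then x else 0)) \<and>
    (\<forall>j\<in>{1..<m}. \<not> ancestor j (nats s' 7 0) \<longrightarrow>
       tree_row m s' i j = duel \<delta> (tree_row m s' i (2 * j)) (tree_row m s' i (2 * j + 1)))" for s'
  define s1 where "s1 = nstore 7 0 (m + z - 1) s"
  define s2 where "s2 = nstore 3 (i * (2 * m) + (m + z - 1)) (if z \<in> B then z else 0) s1"
  have row2: "tree_row m s2 i' j = (if i' = i \<and> j = m + z - 1 then if z \<in> B then z else 0 else tree_row m s i' j)"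
    if "j < 2 * m" for i' j
    unfolding s2_def s1_def using that z by (subst tree_row_nstore) auto
  have I2: "I s2"
    unfolding I_def
  proof (intro conjI ballI impI allI)
    show "reals s2 = reals s" by (simp add: s2_def s1_def)
    show "nats s2 a = nats s a" if "a \<noteq> 3 \<and> a \<noteq> 7" for a using that by (simp add: s2_def s1_def)
    show "tree_row m s2 i' j = tree_row m s i' j" if "i' \<noteq> i \<and> j < 2 * m" for i' j
      using that row2 by simp
    have j: "nats s2 7 0 = m + z - 1" by (simp add: s2_def s1_def)
    show "1 \<le> nats s2 7 0" "nats s2 7 0 < 2 * m" using j z by auto
    show "tree_row m s2 i (m + x - 1) = (if x \<in> B then x else 0)" if "x \<in> {1..m}" for x
    proof (cases "x = z")
      case False
      then have "x \<in> A \<longleftrightarrow> x \<in> B" using AB by blast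
      then show ?thesis using T that row2[of "m + x - 1" i] False z by (auto simp: tournament_def)
    qed (use row2[of "m + x - 1" i] that in auto)
    show "tree_row m s2 i j = duel \<delta> (tree_row m s2 i (2 * j)) (tree_row m s2 i (2 * j + 1))"
      if "j \<in> {1..<m}" "\<not> ancestor j (nats s2 7 0)" for j
    proof -
      \<comment> \<open>Since \<open>j\<close> is not the parent of the written leaf, neither child
        of \<open>j\<close> has changed; nor has \<open>j\<close>, which is an inner node.\<close>
      have "j \<noteq> (m + z - 1) div 2" using that j ancestor_half by metis
      then have "2 * j \<noteq> m + z - 1" "2 * j + 1 \<noteq> m + z - 1" by auto
      then have "tree_row m s2 i (2 * j) = tree_row m s i (2 * j)"
        "tree_row m s2 i (2 * j + 1) = tree_row m s i (2 * j + 1)"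
        "tree_row m s2 i j = tree_row m s i j"
        using that row2[of "2 * j" i] row2[of "2 * j + 1" i] row2[of j i] z by auto
      moreover have "tree_row m s i j = duel \<delta> (tree_row m s i (2 * j)) (tree_row m s i (2 * j + 1))"
        using T that by (simp add: tournament_def)
      ultimately show ?thesis by simp
    qed
  qed
  have pos: "0 < F" using F word_cost_pos[of M] by linarith
  have "wp q M (Suc (floorlog 2 (nats s2 7 0)) * 1) (While (NLess (Const 1) (Var 7)) climb_body) Q s2"
  proof (rule wp_While[where I = I and f = "\<lambda>s. floorlog 2 (nats s 7 0)"])
    fix s' assume I: "I s'" and b: "bval q s' (NLess (Const 1) (Var 7))" and mem: "mem_le M s'"
    define j where "j = nats s' 7 0 div 2"
    have j: "1 \<le> j" "j < m" using I b by (auto simp: I_def j_def)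
    let ?f = "tree_row m s' i"
    let ?s = "nstore 7 0 j s'"
    have s': "nats s' 0 1 = m" "nats s' 6 0 = i" "nats s' 1 = nats s 1"
      using I s by (auto simp: I_def)
    have lc: "nval ?s left_child = ?f (2 * j)" and rc: "nval ?s right_child = ?f (2 * j + 1)"
      using s' by (simp_all add: tree_row_def)
    define u where "u = duel \<delta> (?f (2 * j)) (?f (2 * j + 1))"
    define s3 where "s3 = nstore 3 (i * (2 * m) + j) u ?s"
    have row3: "tree_row m s3 i' j' = (if i' = i \<and> j' = j then u else tree_row m s' i' j')"
      if "j' < 2 * m" for i' j'
      unfolding s3_def using that j by (subst tree_row_nstore) auto
    have I3: "I s3"
      unfolding I_def
    proof (intro conjI ballI impI allI)
      show "reals s3 = reals s" using I by (simp add: s3_def I_def)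
      show "nats s3 a = nats s a" if "a \<noteq> 3 \<and> a \<noteq> 7" for a using that I by (simp add: s3_def I_def)
      show "tree_row m s3 i' j = tree_row m s i' j" if "i' \<noteq> i \<and> j < 2 * m" for i' j
        using that row3 I by (simp add: I_def)
      have j3: "nats s3 7 0 = j" by (simp add: s3_def)
      show "1 \<le> nats s3 7 0" "nats s3 7 0 < 2 * m" using j3 j by auto
      show "tree_row m s3 i (m + x - 1) = (if x \<in> B then x else 0)" if "x \<in> {1..m}" for x
        using that row3[of "m + x - 1" i] I j by (auto simp: I_def)
      show "tree_row m s3 i l = duel \<delta> (tree_row m s3 i (2 * l)) (tree_row m s3 i (2 * l + 1))"
        if l: "l \<in> {1..<m}" "\<not> ancestor l (nats s3 7 0)" for l
      proof -
        have "l \<noteq> j div 2" using l j3 ancestor_half by metis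
        then have "2 * l \<noteq> j" "2 * l + 1 \<noteq> j" by auto
        then have ch: "tree_row m s3 i (2 * l) = ?f (2 * l)" "tree_row m s3 i (2 * l + 1) = ?f (2 * l + 1)"
          using l row3[of "2 * l" i] row3[of "2 * l + 1" i] by auto
        show ?thesis
        proof (cases "l = j")
          case True
          then show ?thesis using row3[of j i] j ch by (simp add: u_def)
        next
          case False
          then have "\<not> ancestor l (nats s' 7 0)"
            using l j3 ancestor_half[of l "nats s' 7 0"] by (auto simp: j_def)
          then have "?f l = duel \<delta> (?f (2 * l)) (?f (2 * l + 1))"
            using I l by (simp add: I_def)
          then show ?thesis using False ch row3[of l i] l by simp
        qed
      qed
    qed
    have dec: "floorlog 2 (nats s3 7 0) < floorlog 2 (nats s' 7 0)"
      using j compute_floorlog[of 2 "nats s' 7 0"] by (auto simp: s3_def j_def)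
    have test: "bval q ?s (And (NLess (Const 0) right_child)
           (Not (And (NLess (Const 0) left_child)
             (Not (RLess (center_dist right_child) (center_dist left_child)))))) \<longleftrightarrow>
        0 < ?f (2 * j + 1) \<and> \<not> (0 < ?f (2 * j) \<and> \<not> \<delta> (?f (2 * j + 1)) < \<delta> (?f (2 * j)))"
      (is "bval q ?s ?B \<longleftrightarrow> ?P")
      using s' by (simp add: tree_row_def \<delta>_def)
    let ?R = "\<lambda>s''. I s'' \<and> floorlog 2 (nats s'' 7 0) < floorlog 2 (nats s' 7 0)"
    have "u \<le> M"
      using mem by (simp add: u_def duel_def mem_le_def tree_row_def)
    then have store: "wp q M 1 (NStore 3 (tree_cell (Var 7)) e) ?R ?s" if "nval ?s e = u" for e
      using that I3 dec s' unfolding s3_def by (intro wp_NStore) simp_all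
    have "wp q M 1 (Cond ?B (NStore 3 (tree_cell (Var 7)) right_child)
        (NStore 3 (tree_cell (Var 7)) left_child)) ?R ?s"
    proof (rule wp_Cond)
      assume "bval q ?s ?B"
      then have "?P" by (rule iffD1[OF test])
      then have "u = ?f (2 * j + 1)" unfolding u_def duel_def by (rule if_P)
      then show "wp q M 1 (NStore 3 (tree_cell (Var 7)) right_child) ?R ?s"
        using rc by (intro store) (simp only:)
    next
      assume "\<not> bval q ?s ?B"
      then have "\<not> ?P" using test by blast
      then have "u = ?f (2 * j)" unfolding u_def duel_def by (rule if_not_P)
      then show "wp q M 1 (NStore 3 (tree_cell (Var 7)) left_child) ?R ?s"
        using lc by (intro store) (simp only:)
    qed simp
    moreover have "nstore 7 (nval s' (Const 0)) (nval s' (NDiv (Var 7) (Const 2))) s' = ?s"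
      by (simp add: j_def)
    moreover have "nval s' (NDiv (Var 7) (Const 2)) \<le> M" using j M by (simp add: j_def)
    ultimately show "wp q M 1 climb_body ?R s'"
      unfolding climb_body_def by (intro wp_Seq wp_NStore) (simp_all only: zero_less_one)
  next
    fix s' assume I: "I s'" and "\<not> bval q s' (NLess (Const 1) (Var 7))"
    then have "1 \<le> nats s' 7 0" "\<not> 1 < nats s' 7 0" by (simp_all add: I_def)
    then have j: "nats s' 7 0 = 1" by linarith
    have "\<not> ancestor l (nats s' 7 0)" if "l \<in> {1..<m}" for l
      unfolding j using that by (intro not_ancestor_1) simp
    then have "tournament \<delta> m B (tree_row m s' i)"
      using I by (simp add: I_def tournament_def)
    then show "Q s'" using I by (intro post) (auto simp: I_def)
  qed (use I2 in auto)
  moreover have "Suc (floorlog 2 (nats s2 7 0)) * 1 \<le> F"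
  proof -
    have "nats s2 7 0 \<le> M" using z M by (simp add: s2_def s1_def)
    then show ?thesis using F floorlog_mono[of "nats s2 7 0" M 2] by (simp add: word_cost_def)
  qed
  ultimately have loop: "wp q M F (While (NLess (Const 1) (Var 7)) climb_body) Q s2"
    using wp_mono by blast
  show ?thesis
    unfolding set_leaf_def
    using F pos loop z M s v by (intro wp_Seq wp_NStore) (auto simp: s2_def s1_def)
qed

section \<open>Correctness and running time\<close>

definition keep :: "nat set \<Rightarrow> state \<Rightarrow> state \<Rightarrow> bool" where
  "keep R s s' \<longleftrightarrow> reals s' = reals s \<and> (\<forall>a. a \<notin> R \<longrightarrow> nats s' a = nats s a)"

lemma keep_refl [simp]: "keep R s s"
  by (simp add: keep_def)

lemma keep_nstore [simp]: "a \<in> R \<Longrightarrow> keep R s s' \<Longrightarrow> keep R s (nstore a i v s')"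
  by (auto simp: keep_def)

lemma keep_trans: "keep R s s' \<Longrightarrow> keep R' s' s'' \<Longrightarrow> R' \<subseteq> R \<Longrightarrow> keep R s s''"
  by (auto simp: keep_def)

lemma keepD: "keep R s s' \<Longrightarrow> a \<notin> R \<Longrightarrow> nats s' a = nats s a"
  by (simp add: keep_def)

lemma atLeast1AtMost_Suc: "{Suc 0..Suc p} = insert (Suc p) {Suc 0..p}"
  by auto

lemma Diff_singleton_nonempty:
  assumes "2 \<le> card A"
  shows "A - {c} \<noteq> {}"
proof
  assume "A - {c} = {}"
  then have "A \<subseteq> {c}" by blast
  then have "card A \<le> 1" using card_mono[of "{c}" A] by simp
  then show False using assms by simp
qed

lemma le_mult_word_cost: "a \<le> b \<Longrightarrow> a \<le> b * word_cost M"
  using mult_le_mono[of a b 1 "word_cost M"] by (simp add: Suc_le_eq)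

text \<open>The program is analysed for arbitrary query answers \<open>q\<close>, positions
  \<open>X\<close> and weights \<open>W\<close>. Here \<open>k\<close> is the number of centers to
  return. The bound \<open>2 * n \<le> M\<close> leaves room for the numbers of tree nodes.\<close>

locale reverse_greedy_run =
  fixes q :: "nat \<Rightarrow> nat \<Rightarrow> real" and M n m k :: nat and X :: "nat \<Rightarrow> nat" and W :: "nat \<Rightarrow> real"
  assumes m: "1 \<le> m" "m \<le> n" and k: "1 \<le> k" "k \<le> m" and M: "2 * n \<le> M"
begin

definition input_ok :: "state \<Rightarrow> bool" where
  "input_ok s \<longleftrightarrow> nats s 0 0 = n \<and> nats s 0 1 = m \<and> nats s 0 2 = k \<and> nats s 1 = X \<and> reals s 0 = W"

definition \<delta> :: "nat \<Rightarrow> nat \<Rightarrow> real" where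
  "\<delta> i z = q i (X (z - 1))"

definition point_ok :: "nat set \<Rightarrow> state \<Rightarrow> nat \<Rightarrow> bool" where
  "point_ok A s i \<longleftrightarrow> nats s 4 i \<in> A \<and> (\<forall>z\<in>A. \<delta> i (nats s 4 i) \<le> \<delta> i z) \<and>
     tournament (\<delta> i) m (A - {nats s 4 i}) (tree_row m s i)"

definition alive :: "nat set \<Rightarrow> state \<Rightarrow> bool" where
  "alive A s \<longleftrightarrow> A \<subseteq> {1..m} \<and> (\<forall>z\<in>{1..m}. nats s 5 z = (if z \<in> A then 0 else 1))"

definition total :: "nat set \<Rightarrow> real" where
  "total A = (\<Sum>i<n. W i * Min (\<delta> i ` A))"

text \<open>Defined from the contents of the memory, which separates its computation from its
  meaning; \<open>total_remove\<close> identifies it with the increase of the objective.\<close>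

definition loss :: "state \<Rightarrow> nat \<Rightarrow> real" where
  "loss s z = (\<Sum>i<n. if nats s 4 i = z then W i * (\<delta> i (tree_row m s i 1) - \<delta> i (nats s 4 i)) else 0)"

definition same_other_points :: "nat \<Rightarrow> state \<Rightarrow> state \<Rightarrow> bool" where
  "same_other_points i s s' \<longleftrightarrow>
     (\<forall>i'. i' \<noteq> i \<longrightarrow> nats s' 4 i' = nats s 4 i' \<and> (\<forall>j<2 * m. tree_row m s' i' j = tree_row m s i' j))"

lemma input_ok_keep: "input_ok s \<Longrightarrow> keep R s s' \<Longrightarrow> 0 \<notin> R \<Longrightarrow> 1 \<notin> R \<Longrightarrow> input_ok s'"
  by (auto simp: input_ok_def keep_def)

lemma input_ok_nstore [simp]: "a \<notin> {0, 1} \<Longrightarrow> input_ok (nstore a i v s) = input_ok s"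
  by (auto simp: input_ok_def)

lemma point_ok_cong:
  assumes "nats s' 4 i = nats s 4 i" "\<And>j. j < 2 * m \<Longrightarrow> tree_row m s' i j = tree_row m s i j"
  shows "point_ok A s' i = point_ok A s i"
  using tournament_cong[of m "tree_row m s' i" "tree_row m s i"] assms by (simp add: point_ok_def)

lemma point_ok_nstore [simp]: "a \<notin> {3, 4} \<Longrightarrow> point_ok A (nstore a i v s) = point_ok A s"
  by (intro ext point_ok_cong) auto

lemma point_ok_other:
  "same_other_points i s s' \<Longrightarrow> i' \<noteq> i \<Longrightarrow> point_ok A s' i' = point_ok A s i'"
  by (intro point_ok_cong) (auto simp: same_other_points_def)

lemma finite_centers: "A \<subseteq> {1..m} \<Longrightarrow> finite A"
  by (rule finite_subset[OF _ finite_atLeastAtMost])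

section \<open>Building the trees of all points\<close>

lemma wp_set_leaf_run:
  assumes "input_ok s" "nats s 6 0 = i" "nats s 11 0 = z" "z \<in> {1..m}"
    and "tournament (\<delta> i) m A (tree_row m s i)"
    and "\<And>x. nval (nstore 7 0 x s) v = (if z \<in> B then z else 0)" "A - {z} = B - {z}"
    and post: "\<And>s'. keep {3, 7} s s' \<Longrightarrow> same_other_points i s s' \<Longrightarrow>
      tournament (\<delta> i) m B (tree_row m s' i) \<Longrightarrow> Q s'"
    and F: "word_cost M \<le> F"
  shows "wp q M F (set_leaf v) Q s"
proof (rule wp_set_leaf[where i = i and z = z and m = m and A = A and B = B])
  have d: "(\<lambda>z. q i (nats s 1 (z - 1))) = \<delta> i"
    using assms(1) by (simp add: input_ok_def \<delta>_def fun_eq_iff)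
  show "tournament (\<lambda>z. q i (nats s 1 (z - 1))) m A (tree_row m s i)"
    unfolding d by (rule assms(5))
  show "Q s'" if "reals s' = reals s" "\<And>a. a \<noteq> 3 \<Longrightarrow> a \<noteq> 7 \<Longrightarrow> nats s' a = nats s a"
    "\<And>i' j. i' \<noteq> i \<Longrightarrow> j < 2 * m \<Longrightarrow> tree_row m s' i' j = tree_row m s i' j"
    "tournament (\<lambda>z. q i (nats s 1 (z - 1))) m B (tree_row m s' i)" for s'
    using that unfolding d by (intro post) (auto simp: keep_def same_other_points_def)
qed (use assms m M in \<open>auto simp: input_ok_def\<close>)

lemma wp_init_point:
  assumes s: "input_ok s" "nats s 6 0 = i" "\<And>j. j < 2 * m \<Longrightarrow> tree_row m s i j = 0"
    and post: "\<And>s'. keep {3, 4, 7, 8, 11} s s' \<Longrightarrow> same_other_points i s s' \<Longrightarrow>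
      point_ok {1..m} s' i \<Longrightarrow> Q s'"
    and F: "Suc m * word_cost M \<le> F"
  shows "wp q M F init_point Q s"
proof -
  \<comment> \<open>After \<open>p\<close> insertions the contestants are the first \<open>p\<close>
    centers; for \<open>p = 0\<close> this is the untouched row of zeros.\<close>
  define I where "I p s' \<longleftrightarrow> keep {3, 7, 8, 11} s s' \<and> same_other_points i s s' \<and>
    tournament (\<delta> i) m {1..p} (tree_row m s' i)" for p and s' :: state
  have F': "word_cost M \<le> F" "0 < F" using F word_cost_pos[of M] by (simp_all del: word_cost_pos)
  have 1: "wp q M (Suc m * word_cost M)
      (For 8 n_centers (Seq (NStore 11 (Const 0) (NAdd (Var 8) (Const 1))) (set_leaf (Var 11)))) (I m) s"
  proof (rule wp_For[where I = I])
    show "nval s' n_centers = m" if "I p s'" for p and s' :: state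
      using that s(1) keepD[of "{3, 7, 8, 11}" s s' 0] by (simp add: I_def input_ok_def)
    show "I 0 (nstore 8 0 0 s)"
      using s(3) by (auto simp: I_def tournament_def duel_def same_other_points_def)
  next
    fix p s' assume p: "p < m" and I: "I p s'" and reg: "nats s' 8 0 = p"
    let ?s = "nstore 11 0 (Suc p) s'"
    have T: "tournament (\<delta> i) m {1..p} (tree_row m ?s i)" using I by (simp add: I_def)
    have ok: "input_ok ?s"
      using I s(1) input_ok_keep[of s "{3, 7, 8, 11}" s'] by (simp add: I_def)
    have "wp q M (word_cost M) (set_leaf (Var 11))
      (\<lambda>s'. nats s' 8 0 = p \<and> I (Suc p) (nstore 8 0 (Suc p) s')) ?s"
    proof (rule wp_set_leaf_run[OF ok _ _ _ T, where B = "{1..Suc p}" and z = "Suc p"])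
      show "nats ?s 6 0 = i" using I s(2) keepD[of "{3, 7, 8, 11}" s s' 6] by (simp add: I_def)
      fix s'' assume k: "keep {3, 7} ?s s''" and o: "same_other_points i ?s s''"
        and t: "tournament (\<delta> i) m {1..Suc p} (tree_row m s'' i)"
      have "nats s'' 8 0 = p" using keepD[OF k, of 8] reg by simp
      moreover have "keep {3, 7, 8, 11} s s''"
        using I k by (auto simp: I_def keep_def)
      moreover have "same_other_points i s s''"
        using I o by (auto simp: I_def same_other_points_def)
      ultimately show "nats s'' 8 0 = p \<and> I (Suc p) (nstore 8 0 (Suc p) s'')"
        using t by (auto simp: I_def same_other_points_def)
    qed (use p in auto)
    then show "wp q M (word_cost M) (Seq (NStore 11 (Const 0) (NAdd (Var 8) (Const 1))) (set_leaf (Var 11)))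
        (\<lambda>s'. nats s' 8 0 = p \<and> I (Suc p) (nstore 8 0 (Suc p) s')) s'"
      using p m M reg by (intro wp_Seq wp_NStore) simp_all
  qed (use m M in auto)
  have 2: "wp q M F (Seq (NStore 4 (Var 6) tree_root)
      (Seq (NStore 11 (Const 0) (NRead 4 (Var 6))) (set_leaf (Const 0)))) Q s'" if I: "I m s'" for s'
  proof -
    define c where "c = tree_row m s' i 1"
    have T: "tournament (\<delta> i) m {1..m} (tree_row m s' i)" using I by (simp add: I_def)
    have c: "c \<in> {1..m}" "\<And>z. z \<in> {1..m} \<Longrightarrow> \<delta> i c \<le> \<delta> i z"
      unfolding c_def using tournament_root[OF T order_refl] m by auto
    have ok: "input_ok s'"
      using I s(1) input_ok_keep[of s "{3, 7, 8, 11}" s'] by (simp add: I_def)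
    have reg: "nats s' 6 0 = i" using I s(2) keepD[of "{3, 7, 8, 11}" s s' 6] by (simp add: I_def)
    let ?s = "nstore 11 0 c (nstore 4 i c s')"
    have "wp q M F (set_leaf (Const 0)) Q ?s"
    proof (rule wp_set_leaf_run[where i = i and z = c and A = "{1..m}" and B = "{1..m} - {c}"])
      fix s'' assume k: "keep {3, 7} ?s s''" and o: "same_other_points i ?s s''"
        and t: "tournament (\<delta> i) m ({1..m} - {c}) (tree_row m s'' i)"
      have "nats s'' 4 i = c" using keepD[OF k, of 4] by simp
      then have "point_ok {1..m} s'' i" using c t by (simp add: point_ok_def)
      moreover have "keep {3, 4, 7, 8, 11} s s''"
        using I k by (auto simp: I_def keep_def)
      moreover have "same_other_points i s s''"
        using I o by (auto simp: I_def same_other_points_def)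
      ultimately show "Q s''" by (intro post)
    qed (use ok reg c T F' in auto)
    moreover have "nval s' tree_root = c"
      using ok reg by (simp add: c_def tree_row_def input_ok_def)
    moreover have "c \<le> M" using c m M by auto
    ultimately show ?thesis
      using reg F' by (intro wp_Seq wp_NStore) simp_all
  qed
  show ?thesis
    unfolding init_point_def by (rule wp_Seq, rule wp_mono[OF 1 F], rule 2)
qed

lemma wp_init:
  assumes s: "input_ok s" "\<And>i. nats s 3 i = 0"
    and post: "\<And>s'. input_ok s' \<Longrightarrow> nats s' 5 = nats s 5 \<Longrightarrow>
      (\<And>i. i < n \<Longrightarrow> point_ok {1..m} s' i) \<Longrightarrow> Q s'"
  shows "wp q M (Suc n * (Suc m * word_cost M)) (For 6 n_points init_point) Q s"
proof -
  \<comment> \<open>Rows of points not yet treated must still be zero, because insertion starts from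
    the empty tree.\<close>
  define I where "I i s' \<longleftrightarrow> input_ok s' \<and> nats s' 5 = nats s 5 \<and> (\<forall>i'<i. point_ok {1..m} s' i') \<and>
    (\<forall>i' j. i \<le> i' \<longrightarrow> j < 2 * m \<longrightarrow> tree_row m s' i' j = 0)" for i and s' :: state
  show ?thesis
  proof (rule wp_For[where I = I])
    show "nval s' n_points = n" if "I i s'" for i and s' :: state
      using that by (simp add: I_def input_ok_def)
    show "I 0 (nstore 6 0 0 s)" using s by (simp add: I_def tree_row_def)
    show "Q s'" if "I n s'" for s' using that by (intro post) (auto simp: I_def)
  next
    fix i s' assume I: "I i s'" and reg: "nats s' 6 0 = i"
    show "wp q M (Suc m * word_cost M) init_point
        (\<lambda>s'. nats s' 6 0 = i \<and> I (Suc i) (nstore 6 0 (Suc i) s')) s'"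
    proof (rule wp_init_point)
      fix s'' assume k: "keep {3, 4, 7, 8, 11} s' s''" and o: "same_other_points i s' s''"
        and p: "point_ok {1..m} s'' i"
      have "input_ok s''" using I input_ok_keep[OF _ k] by (simp add: I_def)
      moreover have "nats s'' 5 = nats s 5" using I keepD[OF k, of 5] by (simp add: I_def)
      moreover have "point_ok {1..m} s'' i'" if "i' < Suc i" for i'
        using that p I point_ok_other[OF o, of i'] by (cases "i' = i") (auto simp: I_def)
      moreover have "tree_row m s'' i' j = 0" if "Suc i \<le> i'" "j < 2 * m" for i' j
        using that o I by (auto simp: I_def same_other_points_def)
      moreover have "nats s'' 6 0 = i" using keepD[OF k, of 6] reg by simp
      ultimately show "nats s'' 6 0 = i \<and> I (Suc i) (nstore 6 0 (Suc i) s'')"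
        by (simp add: I_def)
    qed (use I reg in \<open>auto simp: I_def\<close>)
  qed (use m M in auto)
qed

section \<open>One round: losses, choice and removal\<close>

lemma wp_compute_losses:
  assumes s: "input_ok s"
    and post: "\<And>s'. reals s' 0 = reals s 0 \<Longrightarrow> (\<And>a. a \<noteq> 6 \<Longrightarrow> a \<noteq> 8 \<Longrightarrow> nats s' a = nats s a) \<Longrightarrow>
      (\<And>z. z \<in> {1..m} \<Longrightarrow> reals s' 1 z = loss s z) \<Longrightarrow> Q s'"
    and F: "Suc n \<le> F"
  shows "wp q M F compute_losses Q s"
proof -
  define J where "J s' \<longleftrightarrow> reals s' 0 = reals s 0 \<and> (\<forall>a. a \<noteq> 6 \<and> a \<noteq> 8 \<longrightarrow> nats s' a = nats s a)" for s' :: state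
  have J_ok: "nats s' 0 0 = n" "nats s' 0 (Suc 0) = m" "nats s' (Suc 0) = X" "reals s' 0 = W" if "J s'" for s'
    using that s by (simp_all add: J_def input_ok_def)
  define I1 where "I1 p s' \<longleftrightarrow> J s' \<and> (\<forall>z\<in>{1..p}. reals s' 1 z = 0)" for p and s' :: state
  \<comment> \<open>The loss of \<open>z\<close> restricted to the first \<open>i\<close> points. It
    may refer to the initial state \<open>s\<close>, as both loops change no naturals outside
    registers 6 and 8.\<close>
  define part where "part i z = (\<Sum>i'<i. if nats s 4 i' = z
    then W i' * (\<delta> i' (tree_row m s i' 1) - \<delta> i' (nats s 4 i')) else 0)" for i z
  define I2 where "I2 i s' \<longleftrightarrow> J s' \<and> (\<forall>z\<in>{1..m}. reals s' 1 z = part i z)" for i and s' :: state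
  let ?c1 = "RStore 1 (NAdd (Var 8) (Const 1)) (OfNat (Const 0))"
  let ?c2 = "RStore 1 (NRead 4 (Var 6)) (RAdd (RRead 1 (NRead 4 (Var 6)))
    (RMul (RRead 0 (Var 6)) (RSub (center_dist tree_root) (center_dist (NRead 4 (Var 6))))))"
  have 1: "wp q M (Suc m * 1) (For 8 n_centers ?c1) (I1 m) s"
  proof (rule wp_For[where I = I1])
    show "nval s' n_centers = m" if "I1 p s'" for p and s' :: state
      using that J_ok by (simp add: I1_def)
    show "I1 0 (nstore 8 0 0 s)" by (simp add: I1_def J_def)
    show "wp q M 1 ?c1 (\<lambda>s'. nats s' 8 0 = p \<and> I1 (Suc p) (nstore 8 0 (Suc p) s')) s'"
      if "I1 p s'" "nats s' 8 0 = p" for p and s' :: state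
      using that by (intro wp_RStore) (auto simp: I1_def J_def atLeast1AtMost_Suc)
  qed (use m M in auto)
  have 2: "wp q M (Suc n * 1) (For 6 n_points ?c2) Q s'" if "I1 m s'" for s'
  proof (rule wp_For[where I = I2])
    show "nval s' n_points = n" if "I2 i s'" for i and s' :: state
      using that J_ok by (simp add: I2_def)
    show "I2 0 (nstore 6 0 0 s')" using that by (simp add: I2_def I1_def J_def part_def)
    show "wp q M 1 ?c2 (\<lambda>s'. nats s' 6 0 = i \<and> I2 (Suc i) (nstore 6 0 (Suc i) s')) s'"
      if I: "I2 i s'" and reg: "nats s' 6 0 = i" for i and s' :: state
    proof (rule wp_RStore)
      have J: "J s'" using I by (simp add: I2_def)
      have old: "nats s' 4 = nats s 4" "nats s' 3 = nats s 3" using J by (simp_all add: J_def)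
      let ?c = "nats s 4 i"
      have "rval q s' (RAdd (RRead 1 (NRead 4 (Var 6)))
          (RMul (RRead 0 (Var 6)) (RSub (center_dist tree_root) (center_dist (NRead 4 (Var 6))))))
        = reals s' 1 ?c + W i * (\<delta> i (tree_row m s i 1) - \<delta> i ?c)"
        using J_ok[OF J] reg old by (simp add: \<delta>_def tree_row_def)
      moreover have "nval s' (NRead 4 (Var 6)) = ?c" using reg old by simp
      ultimately show "nats (rstore 1 (nval s' (NRead 4 (Var 6))) (rval q s' (RAdd (RRead 1 (NRead 4 (Var 6)))
          (RMul (RRead 0 (Var 6)) (RSub (center_dist tree_root) (center_dist (NRead 4 (Var 6))))))) s') 6 0 = i
        \<and> I2 (Suc i) (nstore 6 0 (Suc i) (rstore 1 (nval s' (NRead 4 (Var 6))) (rval q s' (RAdd (RRead 1 (NRead 4 (Var 6)))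
          (RMul (RRead 0 (Var 6)) (RSub (center_dist tree_root) (center_dist (NRead 4 (Var 6))))))) s'))"
        using I reg by (auto simp: I2_def J_def part_def simp del: rval.simps nval.simps)
    qed simp
    show "Q s'" if "I2 n s'" for s'
      using that by (intro post) (auto simp: I2_def J_def part_def loss_def)
  qed (use m M in auto)
  show ?thesis
    unfolding compute_losses_def
    using F m by (intro wp_Seq wp_mono[OF 1] wp_mono[OF 2]) auto
qed

lemma wp_select_center:
  assumes s: "input_ok s" "alive A s" "A \<noteq> {}"
    and post: "\<And>s'. keep {8, 10} s s' \<Longrightarrow> nats s' 10 0 \<in> A \<Longrightarrow>
      (\<And>z. z \<in> A \<Longrightarrow> reals s 1 (nats s' 10 0) \<le> reals s 1 z) \<Longrightarrow> Q s'"
    and F: "Suc m \<le> F"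
  shows "wp q M F select_center Q s"
proof -
  \<comment> \<open>Register 10 stays 0 as long as no remaining center has been met, so the first
    one found wins unconditionally.\<close>
  define I where "I p s' \<longleftrightarrow> keep {8, 10} s s' \<and>
    (A \<inter> {1..p} = {} \<longrightarrow> nats s' 10 0 = 0) \<and>
    (A \<inter> {1..p} \<noteq> {} \<longrightarrow> nats s' 10 0 \<in> A \<inter> {1..p} \<and>
       (\<forall>z\<in>A \<inter> {1..p}. reals s 1 (nats s' 10 0) \<le> reals s 1 z))" for p and s' :: state
  let ?test = "And (NLess (NRead 5 (NAdd (Var 8) (Const 1))) (Const 1))
             (Not (And (NLess (Const 0) (Var 10))
               (Not (RLess (RRead 1 (NAdd (Var 8) (Const 1))) (RRead 1 (Var 10))))))"
  have loop: "wp q M (Suc m * 1) (For 8 n_centers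
      (Cond ?test (NStore 10 (Const 0) (NAdd (Var 8) (Const 1))) Skip)) Q (nstore 10 0 0 s)"
  proof (rule wp_For[where I = I])
    show "nval s' n_centers = m" if "I p s'" for p and s' :: state
      using that s(1) keepD[of "{8, 10}" s s' 0] by (simp add: I_def input_ok_def)
    show "I 0 (nstore 8 0 0 (nstore 10 0 0 s))" by (simp add: I_def)
    show "Q s'" if "I m s'" for s'
    proof -
      have "A \<inter> {1..m} = A" using s(2) by (auto simp: alive_def)
      then show ?thesis using that s(3) by (intro post) (simp_all add: I_def)
    qed
  next
    fix p s' assume p: "p < m" and I: "I p s'" and reg: "nats s' 8 0 = p"
    let ?cur = "nats s' 10 0" and ?l = "reals s 1"
    have k: "keep {8, 10} s s'" using I by (simp add: I_def)
    have pos: "0 < ?cur \<longleftrightarrow> A \<inter> {1..p} \<noteq> {}" using I by (auto simp: I_def)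
    have test: "bval q s' ?test \<longleftrightarrow> Suc p \<in> A \<and> \<not> (0 < ?cur \<and> \<not> ?l (Suc p) < ?l ?cur)"
      using s(2) p k reg keepD[OF k, of 5] by (auto simp: alive_def keep_def)
    show "wp q M 1 (Cond ?test (NStore 10 (Const 0) (NAdd (Var 8) (Const 1))) Skip)
        (\<lambda>s'. nats s' 8 0 = p \<and> I (Suc p) (nstore 8 0 (Suc p) s')) s'"
    proof (rule wp_Cond)
      assume "bval q s' ?test"
      then have b: "Suc p \<in> A" "0 < ?cur \<Longrightarrow> ?l (Suc p) < ?l ?cur" using test by auto
      have "?l (Suc p) \<le> ?l z" if "z \<in> A \<inter> {1..Suc p}" for z
      proof (cases "z = Suc p")
        case False
        then have z: "z \<in> A \<inter> {1..p}" using that by auto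
        then have "A \<inter> {1..p} \<noteq> {}" by blast
        then have "0 < ?cur" "?l ?cur \<le> ?l z" using pos I z by (auto simp: I_def)
        then show ?thesis using b(2) by linarith
      qed simp
      moreover have "Suc p \<in> A \<inter> {1..Suc p}" using b(1) by simp
      ultimately have "I (Suc p) (nstore 8 0 (Suc p) (nstore 10 0 (Suc p) s'))"
        using k by (auto simp: I_def)
      then show "wp q M 1 (NStore 10 (Const 0) (NAdd (Var 8) (Const 1)))
          (\<lambda>s'. nats s' 8 0 = p \<and> I (Suc p) (nstore 8 0 (Suc p) s')) s'"
        using reg p m M by (intro wp_NStore) simp_all
    next
      assume nb: "\<not> bval q s' ?test"
      have "I (Suc p) s'"
      proof (cases "Suc p \<in> A")
        case False
        then have eq: "A \<inter> {1..Suc p} = A \<inter> {1..p}" by (auto simp: atLeast1AtMost_Suc)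
        show ?thesis using I unfolding I_def eq .
      next
        case True
        then have b: "0 < ?cur" "?l ?cur \<le> ?l (Suc p)" using nb test by auto
        then have "?cur \<in> A \<inter> {1..p}" "\<forall>z\<in>A \<inter> {1..p}. ?l ?cur \<le> ?l z"
          using I pos by (auto simp: I_def)
        then show ?thesis using b k by (auto simp: I_def atLeast1AtMost_Suc)
      qed
      then have "I (Suc p) (nstore 8 0 (Suc p) s')" by (simp add: I_def)
      then show "wp q M 1 Skip (\<lambda>s'. nats s' 8 0 = p \<and> I (Suc p) (nstore 8 0 (Suc p) s')) s'"
        using reg by (intro wp_Skip) simp_all
    qed simp
  qed (use m M in auto)
  show ?thesis
    unfolding select_center_def using F wp_mono[OF loop, of F Q]
    by (intro wp_Seq wp_NStore) simp_all
qed

text \<open>A point whose nearest center is \<open>z\<close> moves to the root of its tree, and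
  every other point keeps its center. \<open>2 \<le> card A\<close> ensures that the tree has a
  contestant.\<close>

lemma total_remove:
  assumes ok: "\<And>i. i < n \<Longrightarrow> point_ok A s i" and A: "A \<subseteq> {1..m}" "2 \<le> card A" and z: "z \<in> A"
  shows "total (A - {z}) = total A + loss s z"
proof -
  have fin: "finite A" using A(1) by (rule finite_centers)
  have "W i * Min (\<delta> i ` (A - {z})) = W i * Min (\<delta> i ` A) +
      (if nats s 4 i = z then W i * (\<delta> i (tree_row m s i 1) - \<delta> i (nats s 4 i)) else 0)" if i: "i < n" for i
  proof -
    let ?c = "nats s 4 i"
    have c: "?c \<in> A" "\<And>z. z \<in> A \<Longrightarrow> \<delta> i ?c \<le> \<delta> i z"
      and T: "tournament (\<delta> i) m (A - {?c}) (tree_row m s i)"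
      using ok[OF i] by (auto simp: point_ok_def)
    have c_min: "Min (\<delta> i ` A) = \<delta> i ?c"
      using fin c by (rule Min_image_least)
    show ?thesis
    proof (cases "?c = z")
      case True
      have "A - {?c} \<noteq> {}" using A(2) by (rule Diff_singleton_nonempty)
      moreover have "A - {?c} \<subseteq> {1..m}" using A(1) by blast
      ultimately have "Min (\<delta> i ` (A - {?c})) = \<delta> i (tree_row m s i 1)"
        using tournament_root[OF T] fin by (intro Min_image_least) auto
      then show ?thesis using True c_min by (simp add: algebra_simps)
    next
      case False
      then have "Min (\<delta> i ` (A - {z})) = \<delta> i ?c"
        using fin c by (intro Min_image_least) auto
      then show ?thesis using False c_min by simp
    qed
  qed
  then show ?thesis by (simp add: total_def loss_def sum.distrib)
qed

lemma wp_update_point: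
  assumes s: "input_ok s" "nats s 6 0 = i" "nats s 10 0 = y"
    and A: "A \<subseteq> {1..m}" "2 \<le> card A" "y \<in> A" and ok: "point_ok A s i"
    and post: "\<And>s'. keep {3, 4, 7, 11} s s' \<Longrightarrow> same_other_points i s s' \<Longrightarrow>
      point_ok (A - {y}) s' i \<Longrightarrow> Q s'"
    and F: "word_cost M \<le> F"
  shows "wp q M F update_point Q s"
proof -
  define c where "c = nats s 4 i"
  define r where "r = tree_row m s i 1"
  have c: "c \<in> A" "\<And>z. z \<in> A \<Longrightarrow> \<delta> i c \<le> \<delta> i z"
    and T: "tournament (\<delta> i) m (A - {c}) (tree_row m s i)"
    using ok by (auto simp: point_ok_def c_def)
  have "A - {c} \<noteq> {}" using A(2) by (rule Diff_singleton_nonempty)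
  then have r: "r \<in> A - {c}" "\<And>z. z \<in> A - {c} \<Longrightarrow> \<delta> i r \<le> \<delta> i z"
    using tournament_root[OF T] A(1) unfolding r_def by auto
  have F': "0 < F" using F word_cost_pos[of M] by linarith
  \<comment> \<open>\<open>c'\<close> is the new nearest center and \<open>z\<close> the contestant
    to delete. In both cases \<open>A - {c}\<close> and \<open>A - {y} - {c'}\<close> differ at most
    in \<open>z\<close>, so clearing one leaf suffices.\<close>
  define c' where "c' = (if c = y then r else c)"
  define z where "z = (if c = y then r else y)"
  have z: "z \<in> {1..m}" using r(1) A by (auto simp: z_def)
  have yM: "y \<le> M" and rM: "r \<le> M" using A r(1) m M by force+
  have leaf: "wp q M F (set_leaf (Const 0)) Q s'"
    if s': "keep {4, 11} s s'" "nats s' 4 = (nats s 4)(i := c')" "nats s' 11 0 = z" for s'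
  proof (rule wp_set_leaf_run[where i = i and z = z and A = "A - {c}" and B = "A - {y} - {c'}"])
    have "nats s' 3 = nats s 3" using keepD[OF s'(1), of 3] by simp
    then have row: "tree_row m s' = tree_row m s" by (simp add: tree_row_def fun_eq_iff)
    show "tournament (\<delta> i) m (A - {c}) (tree_row m s' i)" using T row by simp
    show "input_ok s'" using input_ok_keep[OF s(1) s'(1)] by simp
    show "nats s' 6 0 = i" using keepD[OF s'(1), of 6] s(2) by simp
    show "A - {c} - {z} = A - {y} - {c'} - {z}"
      by (auto simp: z_def c'_def)
    show "nval (nstore 7 0 x s') (Const 0) = (if z \<in> A - {y} - {c'} then z else 0)" for x
      by (simp add: z_def c'_def)
    fix s'' assume k: "keep {3, 7} s' s''" and o: "same_other_points i s' s''"
      and t: "tournament (\<delta> i) m (A - {y} - {c'}) (tree_row m s'' i)"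
    have "nats s'' 4 i = c'" using keepD[OF k, of 4] s'(2) by simp
    moreover have "c' \<in> A - {y}" using c(1) r(1) by (auto simp: c'_def)
    moreover have "\<delta> i c' \<le> \<delta> i x" if "x \<in> A - {y}" for x
      using that c(2) r(2) by (auto simp: c'_def)
    ultimately have "point_ok (A - {y}) s'' i" using t by (simp add: point_ok_def)
    moreover have "keep {3, 4, 7, 11} s s''"
      using s'(1) k by (auto simp: keep_def)
    moreover have "same_other_points i s s''"
      using o row s'(2) by (auto simp: same_other_points_def)
    ultimately show "Q s''" by (intro post)
  qed (use z s' F in auto)
  let ?s = "nstore 11 0 y s"
  have test: "bval q ?s (And (Not (NLess (NRead 4 (Var 6)) (Var 10))) (Not (NLess (Var 10) (NRead 4 (Var 6))))) \<longleftrightarrow> c = y"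
    (is "bval q ?s ?test \<longleftrightarrow> _")
    using s by (auto simp: c_def)
  have root: "nval s' tree_root = r" if "keep {4, 11} s s'" for s'
    using that s by (simp add: keep_def r_def tree_row_def input_ok_def)
  have "wp q M F (Cond ?test (Seq (NStore 4 (Var 6) tree_root) (NStore 11 (Const 0) tree_root)) Skip)
      (wp q M F (set_leaf (Const 0)) Q) ?s"
  proof (rule wp_Cond)
    assume "bval q ?s ?test"
    then have cy: "c = y" by (rule iffD1[OF test])
    have reg: "nval ?s (Var 6) = i" "\<And>s. nval s (Const 0) = 0" using s(2) by simp_all
    have r1: "nval ?s tree_root = r" "nval (nstore 4 i r ?s) tree_root = r" by (intro root; simp)+
    have "wp q M F (set_leaf (Const 0)) Q (nstore 11 0 r (nstore 4 i r ?s))"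
      using cy by (intro leaf) (auto simp: c'_def z_def)
    then show "wp q M F (Seq (NStore 4 (Var 6) tree_root) (NStore 11 (Const 0) tree_root))
        (wp q M F (set_leaf (Const 0)) Q) ?s"
      using F' rM by (intro wp_Seq wp_NStore) (simp_all only: reg r1)
  next
    assume "\<not> bval q ?s ?test"
    then have cy: "c \<noteq> y" using test by blast
    have "wp q M F (set_leaf (Const 0)) Q ?s"
      using cy by (intro leaf) (auto simp: c'_def z_def c_def)
    then show "wp q M F Skip (wp q M F (set_leaf (Const 0)) Q) ?s"
      using F' by (intro wp_Skip)
  qed (rule F')
  then show ?thesis
    unfolding update_point_def using s(3) F' yM by (intro wp_Seq wp_NStore) simp_all
qed

lemma wp_remove_center:
  assumes s: "input_ok s" "nats s 10 0 = y" "alive A s" "\<And>i. i < n \<Longrightarrow> point_ok A s i"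
    and A: "2 \<le> card A" "y \<in> A"
    and post: "\<And>s'. input_ok s' \<Longrightarrow> nats s' 9 = nats s 9 \<Longrightarrow> alive (A - {y}) s' \<Longrightarrow>
      (\<And>i. i < n \<Longrightarrow> point_ok (A - {y}) s' i) \<Longrightarrow> Q s'"
    and F: "Suc n * word_cost M \<le> F"
  shows "wp q M F remove_center Q s"
proof -
  have Am: "A \<subseteq> {1..m}" using s(3) by (simp add: alive_def)
  let ?s = "nstore 5 y 1 s"
  have F': "0 < F" using F word_cost_pos[of M] by (simp del: word_cost_pos)
  define I where "I i s' \<longleftrightarrow> keep {3, 4, 6, 7, 11} ?s s' \<and> (\<forall>i'<i. point_ok (A - {y}) s' i') \<and>
    (\<forall>i'. i \<le> i' \<longrightarrow> i' < n \<longrightarrow> point_ok A s' i')" for i and s' :: state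
  have I_ok: "input_ok s'" if "I i s'" for i s'
    using that s(1) input_ok_keep[of ?s "{3, 4, 6, 7, 11}" s'] by (simp add: I_def)
  have "wp q M (Suc n * word_cost M) (For 6 n_points update_point) Q ?s"
  proof (rule wp_For[where I = I])
    show "nval s' n_points = n" if "I i s'" for i s'
      using I_ok[OF that] by (simp add: input_ok_def)
    show "I 0 (nstore 6 0 0 ?s)" using s(4) by (simp add: I_def)
    show "Q s'" if I: "I n s'" for s'
    proof (rule post)
      have k: "keep {3, 4, 6, 7, 11} ?s s'" using I by (simp add: I_def)
      show "input_ok s'" using I by (rule I_ok)
      show "nats s' 9 = nats s 9" using keepD[OF k, of 9] by simp
      show "alive (A - {y}) s'"
        using keepD[OF k, of 5] s(3) by (auto simp: alive_def)
      show "point_ok (A - {y}) s' i" if "i < n" for i using I that by (simp add: I_def)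
    qed
  next
    fix i s' assume i: "i < n" and I: "I i s'" and reg: "nats s' 6 0 = i"
    have k: "keep {3, 4, 6, 7, 11} ?s s'" using I by (simp add: I_def)
    show "wp q M (word_cost M) update_point (\<lambda>s'. nats s' 6 0 = i \<and> I (Suc i) (nstore 6 0 (Suc i) s')) s'"
    proof (rule wp_update_point[OF I_ok[OF I] reg _ Am A])
      show "nats s' 10 0 = y" using keepD[OF k, of 10] s(2) by simp
      show "point_ok A s' i" using I i by (simp add: I_def)
      fix s'' assume k': "keep {3, 4, 7, 11} s' s''" and o: "same_other_points i s' s''"
        and p: "point_ok (A - {y}) s'' i"
      have "keep {3, 4, 6, 7, 11} ?s s''" using k k' by (rule keep_trans) auto
      moreover have "point_ok (A - {y}) s'' i'" if "i' < Suc i" for i'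
        using that p I point_ok_other[OF o, of i'] by (cases "i' = i") (auto simp: I_def)
      moreover have "point_ok A s'' i'" if "Suc i \<le> i'" "i' < n" for i'
        using that I point_ok_other[OF o, of i'] by (auto simp: I_def)
      moreover have "nats s'' 6 0 = i" using keepD[OF k', of 6] reg by simp
      ultimately show "nats s'' 6 0 = i \<and> I (Suc i) (nstore 6 0 (Suc i) s'')"
        by (simp add: I_def)
    qed simp
  qed (use m M in auto)
  then have "wp q M F (For 6 n_points update_point) Q ?s" using F by (rule wp_mono)
  then show ?thesis
    unfolding remove_center_def using s(2) F' m M by (intro wp_Seq wp_NStore) simp_all
qed

section \<open>All rounds and the output\<close>

lemma wp_rounds:
  assumes s: "input_ok s" "alive {1..m} s" "\<And>i. i < n \<Longrightarrow> point_ok {1..m} s i"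
    and post: "\<And>A s'. input_ok s' \<Longrightarrow> alive A s' \<Longrightarrow> card A = k \<Longrightarrow> reverse_greedy total {1..m} A \<Longrightarrow> Q s'"
    and F: "Suc m * (Suc n * word_cost M) \<le> F"
  shows "wp q M F (For 9 (NSub n_centers n_output) (Seq compute_losses (Seq select_center remove_center))) Q s"
proof -
  define I where "I t s' \<longleftrightarrow> input_ok s' \<and> (\<exists>A. alive A s' \<and> card A = m - t \<and>
    (\<forall>i<n. point_ok A s' i) \<and> reverse_greedy total {1..m} A)" for t and s' :: state
  have "wp q M (Suc (m - k) * (Suc n * word_cost M))
      (For 9 (NSub n_centers n_output) (Seq compute_losses (Seq select_center remove_center))) Q s"
  proof (rule wp_For[where I = I])
    show "nval s' (NSub n_centers n_output) = m - k" if "I t s'" for t s'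
      using that by (simp add: I_def input_ok_def)
    show "I 0 (nstore 9 0 0 s)"
      using s reverse_greedy.start[of total "{1..m}"] by (auto simp: I_def alive_def)
    show "Q s'" if "I (m - k) s'" for s'
      using that k post by (auto simp: I_def)
  next
    fix t s' assume t: "t < m - k" and I: "I t s'" and reg: "nats s' 9 0 = t"
    obtain A where A: "alive A s'" "card A = m - t" "\<And>i. i < n \<Longrightarrow> point_ok A s' i"
        "reverse_greedy total {1..m} A" and ok: "input_ok s'"
      using I by (auto simp: I_def)
    \<comment> \<open>Before each round more than \<open>k\<close> centers are left and
      \<open>1 \<le> k\<close>, so a second nearest center exists.\<close>
    have A2: "2 \<le> card A" using A(2) t k by simp
    have Am: "A \<subseteq> {1..m}" using A(1) by (simp add: alive_def)
    show "wp q M (Suc n * word_cost M) (Seq compute_losses (Seq select_center remove_center))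
        (\<lambda>s'. nats s' 9 0 = t \<and> I (Suc t) (nstore 9 0 (Suc t) s')) s'"
    proof (intro wp_Seq wp_compute_losses[OF ok])
      fix s1 :: state assume s1: "reals s1 0 = reals s' 0" "\<And>a. a \<noteq> 6 \<Longrightarrow> a \<noteq> 8 \<Longrightarrow> nats s1 a = nats s' a"
        "\<And>z. z \<in> {1..m} \<Longrightarrow> reals s1 1 z = loss s' z"
      have ok1: "input_ok s1" using ok s1 by (simp add: input_ok_def)
      have A1: "alive A s1" using A(1) s1(2)[of 5] by (simp add: alive_def)
      show "wp q M (Suc n * word_cost M) select_center (wp q M (Suc n * word_cost M) remove_center
          (\<lambda>s'. nats s' 9 0 = t \<and> I (Suc t) (nstore 9 0 (Suc t) s'))) s1"
      proof (rule wp_select_center[OF ok1 A1])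
        show "A \<noteq> {}" using A2 by auto
        \<comment> \<open>Loops over the centers fit into the budget of a round because
          \<open>m \<le> n\<close>.\<close>
        show "Suc m \<le> Suc n * word_cost M"
          using m by (intro le_mult_word_cost) simp
        fix s2 assume k2: "keep {8, 10} s1 s2" and y: "nats s2 10 0 \<in> A"
          and least: "\<And>z. z \<in> A \<Longrightarrow> reals s1 1 (nats s2 10 0) \<le> reals s1 1 z"
        let ?y = "nats s2 10 0"
        have old: "nats s2 a = nats s' a" if "a \<notin> {6, 8, 10}" for a
          using that keepD[OF k2, of a] s1(2)[of a] by simp
        have "reverse_greedy total {1..m} (A - {?y})"
          using A(4) y
        proof (rule reverse_greedy.remove)
          fix z assume z: "z \<in> A"
          have "?y \<in> {1..m}" "z \<in> {1..m}" using y z Am by auto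
          then have "loss s' ?y \<le> loss s' z" using least[OF z] s1(3) by simp
          then show "total (A - {?y}) \<le> total (A - {z})"
            using total_remove[OF A(3) Am A2] y z by simp
        qed
        moreover have "card (A - {?y}) = m - Suc t"
          using A(2) y finite_centers[OF Am] by simp
        ultimately have next_round: "I (Suc t) (nstore 9 0 (Suc t) s3)"
          if "input_ok s3" "alive (A - {?y}) s3" "\<And>i. i < n \<Longrightarrow> point_ok (A - {?y}) s3 i" for s3
          using that by (auto simp: I_def alive_def intro!: exI[of _ "A - {?y}"])
        show "wp q M (Suc n * word_cost M) remove_center
            (\<lambda>s'. nats s' 9 0 = t \<and> I (Suc t) (nstore 9 0 (Suc t) s')) s2"
        proof (rule wp_remove_center[where A = A])
          show "input_ok s2" using input_ok_keep[OF ok1 k2] by simp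
          show "alive A s2" using A(1) old[of 5] by (simp add: alive_def)
          show "point_ok A s2 i" if "i < n" for i
            using A(3)[OF that] old[of 3] old[of 4] point_ok_cong[of s2 i s'] by (simp add: tree_row_def)
          show "nats s3 9 0 = t \<and> I (Suc t) (nstore 9 0 (Suc t) s3)"
            if "input_ok s3" "nats s3 9 = nats s2 9" "alive (A - {?y}) s3"
              "\<And>i. i < n \<Longrightarrow> point_ok (A - {?y}) s3 i" for s3
            using that next_round reg old[of 9] by simp
        qed (use A2 y in auto)
      qed
    qed (intro le_mult_word_cost order_refl)
  qed (use m M in auto)
  moreover have "Suc (m - k) * (Suc n * word_cost M) \<le> F"
    using F mult_le_mono1[of "Suc (m - k)" "Suc m" "Suc n * word_cost M"] by linarith
  ultimately show ?thesis using wp_mono by blast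
qed

lemma wp_write_output:
  assumes s: "input_ok s" "alive A s" and X: "\<And>p. p < m \<Longrightarrow> X p \<le> M"
    and post: "\<And>s'. nats s' 2 ` {..<card A} = (\<lambda>z. X (z - 1)) ` A \<Longrightarrow> Q s'"
    and F: "Suc m \<le> F"
  shows "wp q M F write_output Q s"
proof -
  have Am: "A \<subseteq> {1..m}" using s(2) by (simp add: alive_def)
  \<comment> \<open>The number of remaining centers met so far is also the next free output
    cell.\<close>
  define I where "I p s' \<longleftrightarrow> keep {2, 8, 12} s s' \<and> nats s' 12 0 = card (A \<inter> {1..p}) \<and>
    nats s' 2 ` {..<card (A \<inter> {1..p})} = (\<lambda>z. X (z - 1)) ` (A \<inter> {1..p})" for p and s' :: state
  let ?test = "NLess (NRead 5 (NAdd (Var 8) (Const 1))) (Const 1)"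
  let ?write = "Seq (NStore 2 (Var 12) (NRead 1 (Var 8))) (NStore 12 (Const 0) (NAdd (Var 12) (Const 1)))"
  have loop: "wp q M (Suc m * 1) (For 8 n_centers (Cond ?test ?write Skip)) Q (nstore 12 0 0 s)"
  proof (rule wp_For[where I = I])
    show "nval s' n_centers = m" if "I p s'" for p s'
      using that s(1) keepD[of "{2, 8, 12}" s s' 0] by (simp add: I_def input_ok_def)
    show "I 0 (nstore 8 0 0 (nstore 12 0 0 s))" by (simp add: I_def)
    show "Q s'" if "I m s'" for s'
    proof -
      have "A \<inter> {1..m} = A" using Am by blast
      then show ?thesis using that by (intro post) (simp add: I_def)
    qed
  next
    fix p s' assume p: "p < m" and I: "I p s'" and reg: "nats s' 8 0 = p"
    let ?c = "card (A \<inter> {1..p})"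
    have k: "keep {2, 8, 12} s s'" and cnt: "nats s' 12 0 = ?c"
      and img: "nats s' 2 ` {..<?c} = (\<lambda>z. X (z - 1)) ` (A \<inter> {1..p})"
      using I by (auto simp: I_def)
    have in1: "nats s' 1 = X" using keepD[OF k, of 1] s(1) by (simp add: input_ok_def)
    have test: "bval q s' ?test \<longleftrightarrow> Suc p \<in> A"
      using s(2) p reg keepD[OF k, of 5] by (auto simp: alive_def)
    show "wp q M 1 (Cond ?test ?write Skip)
        (\<lambda>s'. nats s' 8 0 = p \<and> I (Suc p) (nstore 8 0 (Suc p) s')) s'"
    proof (rule wp_Cond)
      assume "bval q s' ?test"
      then have "A \<inter> {1..Suc p} = insert (Suc p) (A \<inter> {1..p})"
        using test by (auto simp: atLeast1AtMost_Suc)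
      moreover from this have "card (A \<inter> {1..Suc p}) = Suc ?c" by simp
      moreover have "((nats s' 2)(?c := X p)) ` {..<Suc ?c} = insert (X p) (nats s' 2 ` {..<?c})"
        by (auto simp: lessThan_Suc)
      ultimately have "I (Suc p) (nstore 8 0 (Suc p) (nstore 12 0 (Suc ?c) (nstore 2 ?c (X p) s')))"
        using k img by (simp add: I_def)
      moreover have "?c \<le> p" using card_mono[of "{1..p}" "A \<inter> {1..p}"] by simp
      ultimately show "wp q M 1 ?write (\<lambda>s'. nats s' 8 0 = p \<and> I (Suc p) (nstore 8 0 (Suc p) s')) s'"
        using reg p m M cnt in1 X[OF p] by (intro wp_Seq wp_NStore) simp_all
    next
      assume "\<not> bval q s' ?test"
      then have "A \<inter> {1..Suc p} = A \<inter> {1..p}" using test by (auto simp: atLeast1AtMost_Suc)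
      then have "I (Suc p) (nstore 8 0 (Suc p) s')" using I by (simp add: I_def)
      then show "wp q M 1 Skip (\<lambda>s'. nats s' 8 0 = p \<and> I (Suc p) (nstore 8 0 (Suc p) s')) s'"
        using reg by (intro wp_Skip) simp_all
    qed simp
  qed (use m M in auto)
  show ?thesis
    unfolding write_output_def using F wp_mono[OF loop, of F Q]
    by (intro wp_Seq wp_NStore) simp_all
qed

text \<open>Initialization and all rounds together make on the order of \<open>n * m\<close> tree
  updates, each along one path; this budget covers every phase.\<close>

lemma wp_reverse_greedy_program:
  assumes s: "input_ok s" "\<And>i. nats s 3 i = 0" "\<And>z. nats s 5 z = 0" and X: "\<And>p. p < m \<Longrightarrow> X p \<le> M"
  shows "wp q M (Suc n * (Suc m * word_cost M)) reverse_greedy_program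
    (\<lambda>s'. \<exists>A. reverse_greedy total {1..m} A \<and> card A = k \<and>
      nats s' 2 ` {..<k} = (\<lambda>z. X (z - 1)) ` A) s"
  unfolding reverse_greedy_program_def
proof (rule wp_Seq, rule wp_init[OF s(1,2)], rule wp_Seq)
  fix s1 assume s1: "input_ok s1" "nats s1 5 = nats s 5" "\<And>i. i < n \<Longrightarrow> point_ok {1..m} s1 i"
  have "alive {1..m} s1" using s1(2) s(3) by (simp add: alive_def)
  then show "wp q M (Suc n * (Suc m * word_cost M))
      (For 9 (NSub n_centers n_output) (Seq compute_losses (Seq select_center remove_center)))
      (wp q M (Suc n * (Suc m * word_cost M)) write_output (\<lambda>s'. \<exists>A. reverse_greedy total {1..m} A \<and>
        card A = k \<and> nats s' 2 ` {..<k} = (\<lambda>z. X (z - 1)) ` A)) s1"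
  proof (rule wp_rounds[OF s1(1) _ s1(3)])
    fix A s2 assume A: "input_ok s2" "alive A s2" "card A = k" "reverse_greedy total {1..m} A"
    show "wp q M (Suc n * (Suc m * word_cost M)) write_output (\<lambda>s'. \<exists>A. reverse_greedy total {1..m} A \<and>
        card A = k \<and> nats s' 2 ` {..<k} = (\<lambda>z. X (z - 1)) ` A) s2"
    proof (rule wp_write_output[OF A(1,2) X])
      show "Suc m \<le> Suc n * (Suc m * word_cost M)"
      proof -
        have "Suc m * 1 \<le> Suc m * word_cost M" by (simp add: le_mult_word_cost del: mult_Suc)
        also have "\<dots> \<le> Suc n * (Suc m * word_cost M)" by simp
        finally show ?thesis by simp
      qed
    qed (use A(3,4) in \<open>auto intro!: exI[of _ A]\<close>)
  qed (simp_all add: algebra_simps)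
qed

end

text \<open>Injectivity of \<open>h\<close> makes the removal of a center number the removal of one
  point, so cheapest choices correspond.\<close>

lemma reverse_greedy_image:
  assumes "reverse_greedy g X A" "inj_on h X" "\<And>B. B \<subseteq> X \<Longrightarrow> g B = f (h ` B)"
  shows "reverse_greedy f (h ` X) (h ` A)"
  using assms(1)
proof (induction rule: reverse_greedy.induct)
  case start
  show ?case by (rule reverse_greedy.start)
next
  case (remove A y)
  have AX: "A \<subseteq> X" using remove(1) by (rule reverse_greedy_subset)
  have img: "h ` (A - {z}) = h ` A - {h z}" if "z \<in> A" for z
    using inj_on_image_set_diff[OF assms(2), of A "{z}"] AX that by auto
  have val: "g (A - {z}) = f (h ` A - {h z})" if "z \<in> A" for z
    using assms(3)[of "A - {z}"] AX img[OF that] by auto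
  have "reverse_greedy f (h ` X) (h ` A - {h y})"
    using remove(4)
  proof (rule reverse_greedy.remove)
    show "h y \<in> h ` A" using remove(2) by (rule imageI)
    fix x assume "x \<in> h ` A"
    then obtain z where z: "z \<in> A" "x = h z" by blast
    show "f (h ` A - {h y}) \<le> f (h ` A - {x})"
      using remove(3)[OF z(1)] val[OF remove(2)] val[OF z(1)] z(2) by simp
  qed
  then show ?case using img[OF remove(2)] by simp
qed

text \<open>Doubling \<open>n\<close> adds one bit, so the word cost is at most
  \<open>log 2 n + 3\<close>; and \<open>log 2 n \<le> 2 * ln n\<close> because \<open>ln 2\<close>
  is at least one half.\<close>

lemma word_cost_double_le:
  assumes "1 \<le> n"
  shows "real (word_cost (2 * n)) \<le> 2 * (2 + ln (real n))"
proof -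
  have "word_cost (2 * n) = floorlog 2 n + 2"
    using assms compute_floorlog[of 2 "2 * n"] by (simp add: word_cost_def)
  also have "floorlog 2 n = nat \<lfloor>log 2 n\<rfloor> + 1"
    using assms by (simp add: floorlog_def)
  finally have "real (word_cost (2 * n)) = real (nat \<lfloor>log 2 n\<rfloor>) + 3" by simp
  moreover have "0 \<le> log 2 n" using assms by simp
  ultimately have "real (word_cost (2 * n)) \<le> log 2 n + 3" by linarith
  also have "log 2 n \<le> 2 * ln n"
  proof -
    have "ln n * 1 \<le> ln n * (2 * ln 2)"
      using assms ln2_ge_two_thirds by (intro mult_left_mono) auto
    then show ?thesis by (simp add: log_def field_simps)
  qed
  finally show ?thesis by simp
qed

theorem theorem4p1:
  shows "\<exists>(P :: com) (C :: real) (T :: real) (p :: nat).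
    \<forall>(V :: 'a set) w d X k k' vs xs.
      weighted_metric_space V w d \<and> X \<subseteq> V \<and>
      1 \<le> k \<and> k \<le> k' \<and> k' \<le> card X \<and>
      distinct vs \<and> set vs = V \<and>
      distinct xs \<and> set xs \<subseteq> {..<length vs} \<and> (!) vs ` set xs = X \<longrightarrow>
      (\<exists>t s S.
        exec (dist_query vs d) P (input_state vs w xs k') t s \<and>
        returns vs k' s S \<and>
        S \<subseteq> X \<and> card S = k' \<and>
        real t \<le> T * (real (card V) * real (card X)) *
          (2 + ln (real (card V)) + ln (aspect_ratio V d)) ^ p \<and>
        cost w d S V \<le> cost w d X V +
          C * ln (real (card X) / (real k' - real k + 1)) * OPT V w d k)"
proof (rule exI[of _ reverse_greedy_program], rule exI[of _ 4],
    rule exI[of _ "16 * real (ccoeff reverse_greedy_program)"], rule exI[of _ 2],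
    intro allI impI, elim conjE)
  fix V :: "'a set" and w d X k k' vs xs
  assume "weighted_metric_space V w d" and XV: "X \<subseteq> V" and k: "1 \<le> k" "k \<le> k'" "k' \<le> card X"
    and vs: "distinct vs" "set vs = V"
    and xs: "distinct xs" "set xs \<subseteq> {..<length vs}" "(!) vs ` set xs = X"
  interpret weighted_metric_space V w d by fact
  define n m where "n = length vs" and "m = length xs"
  have n: "card V = n" using distinct_card[OF vs(1)] vs(2) by (simp add: n_def)
  have inj_vs: "inj_on ((!) vs) {..<n}"
    using vs(1) by (auto simp: inj_on_def n_def nth_eq_iff_index_eq)
  have m: "card X = m"
    using card_image[OF inj_on_subset[OF inj_vs], of "set xs"] xs distinct_card[OF xs(1)]
    by (simp add: n_def m_def)
  have mn: "m \<le> n" using card_mono[OF finite_space XV] n m by simp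
  have m1: "1 \<le> m" using k m by simp
  have xs_less: "cells xs p < n" if "p < m" for p
  proof -
    have "xs ! p \<in> set xs" using that by (simp add: m_def)
    then have "xs ! p < n" using xs(2) by (auto simp: n_def)
    then show ?thesis using that by (simp add: cells_def m_def)
  qed
  let ?q = "dist_query vs d" and ?M = "2 * n" and ?s = "input_state vs w xs k'"
  let ?L = "word_cost ?M"
  \<comment> \<open>The locale parameter \<open>k\<close> becomes the output size \<open>k'\<close>,
    not the number of centers of the optimum.\<close>
  interpret R: reverse_greedy_run ?q ?M n m k' "cells xs" "cells (map w vs)"
    using m1 mn k m by unfold_locales auto
  have M2: "2 \<le> ?M" using m1 mn by simp
  have "cells [n, m, k'] i \<le> ?M" for i
    using mn k m by (auto simp: cells_def nth_Cons split: nat.splits)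
  moreover have xs_le: "cells xs i \<le> ?M" for i
    using xs_less[of i] by (cases "i < m") (auto simp: cells_def m_def)
  ultimately have mem: "mem_le ?M ?s"
    by (simp add: mem_le_def input_state_def n_def m_def)
  have "R.input_ok ?s"
    unfolding R.input_ok_def by (simp add: input_state_def n_def m_def cells_def[of "[_, _, _]"])
  then have "wp ?q ?M (Suc n * (Suc m * ?L)) reverse_greedy_program
    (\<lambda>s'. \<exists>A. reverse_greedy R.total {1..m} A \<and> card A = k' \<and>
      nats s' 2 ` {..<k'} = (\<lambda>z. cells xs (z - 1)) ` A) ?s"
    using xs_le by (intro R.wp_reverse_greedy_program) (simp_all add: input_state_def)
  then obtain t s A where run: "exec ?q reverse_greedy_program ?s t s"
    and t: "t \<le> ccoeff reverse_greedy_program * (Suc n * (Suc m * ?L) * ?L)"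
    and A: "reverse_greedy R.total {1..m} A" "card A = k'"
    and out: "nats s 2 ` {..<k'} = (\<lambda>z. cells xs (z - 1)) ` A"
    using M2 mem unfolding wp_def by blast
  \<comment> \<open>Centers are numbered from 1 in the program but the entries of \<open>xs\<close>
    from 0.\<close>
  define h where "h z = vs ! cells xs (z - 1)" for z
  have Am: "A \<subseteq> {1..m}" using A(1) by (rule reverse_greedy_subset)
  have inj_h: "inj_on h {1..m}"
  proof (rule inj_onI)
    fix y z assume yz: "y \<in> {1..m}" "z \<in> {1..m}" "h y = h z"
    then have less: "y - 1 < m" "z - 1 < m" by auto
    then have "cells xs (y - 1) = cells xs (z - 1)"
      using inj_onD[OF inj_vs yz(3)[unfolded h_def]] xs_less by simp
    then have "y - 1 = z - 1"
      using xs(1) less by (simp add: cells_def m_def nth_eq_iff_index_eq)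
    then show "y = z" using yz by auto
  qed
  have image_h: "h ` {1..m} = X"
  proof -
    have "(\<lambda>z. cells xs (z - 1)) ` {1..m} = cells xs ` {..<m}"
    proof -
      have "(\<lambda>z. z - 1) ` {1..m} = {..<m}"
        by (auto intro!: image_eqI[of _ _ "Suc _"])
      then show ?thesis by (metis image_image)
    qed
    also have "\<dots> = set xs"
      by (auto simp: cells_def m_def set_conv_nth)
    finally show ?thesis using xs(3) unfolding h_def by (metis image_image)
  qed
  \<comment> \<open>All positions that occur lie within \<open>vs\<close>, so the default answer 0
    of \<open>dist_query\<close> never enters the objective.\<close>
  have total: "R.total B = cost w d (h ` B) V" if "B \<subseteq> {1..m}" for B
  proof -
    have "cost w d (h ` B) V = (\<Sum>i<n. w (vs ! i) * dist_set d (vs ! i) (h ` B))"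
      unfolding cost_def using bij_betw_nth[OF vs(1) refl, of V] vs(2) n_def
      by (intro sum.reindex_bij_betw[symmetric]) simp
    also have "\<dots> = R.total B"
      unfolding R.total_def
    proof (intro sum.cong refl)
      fix i assume "i \<in> {..<n}"
      moreover from this have "R.\<delta> i z = d (vs ! i) (h z)" if "z \<in> B" for z
      proof -
        have "z \<in> {1..m}" using \<open>z \<in> B\<close> \<open>B \<subseteq> {1..m}\<close> by blast
        then have "z - 1 < m" by auto
        then have "cells xs (z - 1) < n" by (rule xs_less)
        then show ?thesis
          using \<open>i \<in> {..<n}\<close> by (simp add: R.\<delta>_def dist_query_def h_def n_def)
      qed
      then have "R.\<delta> i ` B = d (vs ! i) ` h ` B"
        by (simp add: image_image cong: image_cong)
      ultimately show "w (vs ! i) * dist_set d (vs ! i) (h ` B) = cells (map w vs) i * Min (R.\<delta> i ` B)"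
        by (simp add: dist_set_def cells_def n_def)
    qed
    finally show ?thesis ..
  qed
  have greedy: "reverse_greedy (\<lambda>S. cost w d S V) X (h ` A)"
    using reverse_greedy_image[OF A(1) inj_h total] image_h by simp
  have card_hA: "card (h ` A) = k'"
    using card_image[OF inj_on_subset[OF inj_h Am]] A(2) by simp
  have "nats s 2 i < n" if "i < k'" for i
  proof -
    have "nats s 2 i \<in> (\<lambda>z. cells xs (z - 1)) ` A" using out that by blast
    then show ?thesis using xs_less Am by fastforce
  qed
  moreover have "h ` A = (\<lambda>i. vs ! nats s 2 i) ` {..<k'}"
  proof -
    have "h ` A = (!) vs ` ((\<lambda>z. cells xs (z - 1)) ` A)" by (simp add: h_def image_image)
    also have "\<dots> = (!) vs ` (nats s 2 ` {..<k'})" by (simp only: out)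
    finally show ?thesis by (simp add: image_image)
  qed
  ultimately have ret: "returns vs k' s (h ` A)" by (simp add: returns_def n_def)
  let ?D = "2 + ln (real n) + ln (aspect_ratio V d)"
  have "0 \<le> ln (aspect_ratio V d)" using aspect_ratio_ge_1 by simp
  then have L: "real ?L \<le> 2 * ?D" using word_cost_double_le[of n] m1 mn by simp
  \<comment> \<open>One factor \<open>?L\<close> bounds the steps along a tree path, the other the
    cost of operations on naturals, hence the exponent 2. Each is at most \<open>2 * ?D\<close>,
    while \<open>Suc n \<le> 2 * n\<close> and \<open>Suc m \<le> 2 * m\<close>; the four factors 2
    give 16.\<close>
  have "real t \<le> real (ccoeff reverse_greedy_program * (Suc n * (Suc m * ?L) * ?L))"
    using t by (simp only: of_nat_le_iff)
  also have "\<dots> = real (ccoeff reverse_greedy_program) * ((real (Suc n) * real (Suc m)) * (real ?L * real ?L))"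
    by (simp only: of_nat_mult mult.assoc)
  also have "\<dots> \<le> real (ccoeff reverse_greedy_program) *
      (((2 * real n) * (2 * real m)) * ((2 * ?D) * (2 * ?D)))"
    using m1 mn L by (intro mult_left_mono mult_mono) auto
  also have "\<dots> = 16 * real (ccoeff reverse_greedy_program) * (real n * real m) * ?D ^ 2"
  proof -
    have "c * (((2 * x) * (2 * y)) * ((2 * D) * (2 * D))) = 16 * c * (x * y) * D ^ 2" for c x y D :: real
      by (simp add: power2_eq_square)
    then show ?thesis .
  qed
  finally have time: "real t \<le> 16 * real (ccoeff reverse_greedy_program) *
    (real (card V) * real (card X)) * (2 + ln (real (card V)) + ln (aspect_ratio V d)) ^ 2"
    by (simp only: n m)
  have "cost w d (h ` A) V \<le> cost w d X V
      + 4 * ln (real (card X) / (real k' - real k + 1)) * OPT V w d k"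
    using reverse_greedy_cost[OF greedy XV k(1)] k(2) card_hA by simp
  then show "\<exists>t s S. exec ?q reverse_greedy_program ?s t s \<and> returns vs k' s S \<and>
      S \<subseteq> X \<and> card S = k' \<and>
      real t \<le> 16 * real (ccoeff reverse_greedy_program) * (real (card V) * real (card X)) *
        (2 + ln (real (card V)) + ln (aspect_ratio V d)) ^ 2 \<and>
      cost w d S V \<le> cost w d X V + 4 * ln (real (card X) / (real k' - real k + 1)) * OPT V w d k"
    using run ret time card_hA reverse_greedy_subset[OF greedy] by blast
qed

end
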